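(* Let $\nu\in\mathbb{N}_0$, $R>0$, and let $\omega,\sigma\in\mathbb{C}$ with $\Im(\sigma)>0$ and $\Im(\sigma\omega)>0$. Then there exist constants $c_1,c_2>0$, independent of $N$, such that for all $N\in\mathbb{N}$ $$\inf_{u_N\in\tilde{\mathcal X}_N}\left\|h_\nu(\omega(R+\sigma\,\cdot\,))-u_N\right\|_{L_2(\mathbb{R}_{\ge 0})}\le c_1\left|\frac{1+i\sigma\omega}{1-i\sigma\omega}\right|^{N+1}+c_2\exp\left(-2\,\Re\sqrt{\frac{2R(N+1)}{\sigma}}\right)(N+1)^{\frac{\nu}{2}}.$$
   Context: $L_2(\mathbb{R}_{\ge 0})$ is the space of complex-valued square integrable functions on $[0,\infty)$. For $n\in\mathbb{N}_0$ let $L_n(x)=\sum_{k=0}^n\binom{n}{k}\frac{(-x)^k}{k!}$ be the Laguerre polynomial and $\phi_n(x)=\exp(-x)L_n(2x)$ the Laguerre function; $\tilde{\mathcal X}_N=\mathrm{span}\{\phi_n: n=0,\ldots,N\}$ (complex span). For $\nu\in\mathbb{N}_0$ the spherical Hankel function of the first kind is $$h_\nu(z)=-\frac{i}{z}\exp(iz)\,(-i)^\nu\sum_{m=0}^{\nu}\frac{i^m}{m!(2z)^m}\frac{(\nu+m)!}{(\nu-m)!},\qquad z\in\mathbb{C}\setminus\{0\},$$ and $h_\nu(\omega(R+\sigma\,\cdot\,))$ denotes the function $\xi\mapsto h_\nu(\omega(R+\sigma\xi))$ on $[0,\infty)$. The square root $\sqrt z$ for $z\in\mathbb{C}\setminus\mathbb{R}_{\le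 0}$ is the principal branch. *)

theory Defs
  imports "HOL-Analysis.Analysis" "HOL-Library.Function_Algebras"
begin

definition L2_half_line :: "(real \<Rightarrow> complex) set" where
  "L2_half_line = {f. f \<in> borel_measurable (lebesgue_on {0..}) \<and>
                      integrable (lebesgue_on {0..}) (\<lambda>x. (cmod (f x))\<^sup>2)}"

(* The norm is extended by the value \<infinity> outside of L2: the Bochner integral of a
   non-integrable function is 0, so a real-valued norm would be 0 there. Hence a finite bound
   on the norm of f contains the assertion that f is square integrable. *)
definition L2_norm :: "(real \<Rightarrow> complex) \<Rightarrow> ereal" where
  "L2_norm f = (if f \<in> L2_half_line
                then ereal (sqrt (\<integral>x. (cmod (f x))\<^sup>2 \<partial>lebesgue_on {0..})) else \<infinity>)"

definition laguerre_poly :: "nat \<Rightarrow> real \<Rightarrow> real" where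
  "laguerre_poly n x = (\<Sum>k\<le>n. real (n choose k) * ((- x) ^ k / fact k))"

definition laguerre_fun :: "nat \<Rightarrow> real \<Rightarrow> complex" where
  "laguerre_fun n x = complex_of_real (exp (- x) * laguerre_poly n (2 * x))"

(* The vector space operations of real \<Rightarrow> complex are pointwise, with complex scalars;
   the unqualified constant span would be the span over the reals. *)
definition complex_fun_scale :: "complex \<Rightarrow> (real \<Rightarrow> complex) \<Rightarrow> real \<Rightarrow> complex" where
  "complex_fun_scale c f = (\<lambda>x. c * f x)"

lemma vector_space_complex_fun_scale: "vector_space complex_fun_scale"
  by unfold_locales (auto simp: complex_fun_scale_def fun_eq_iff algebra_simps)

definition laguerre_space :: "nat \<Rightarrow> (real \<Rightarrow> complex) set" where
  "laguerre_space N = module.span complex_fun_scale (laguerre_fun ` {..N})"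

lemma sum_complex_fun_scale_apply:
  "(\<Sum>i\<in>A. complex_fun_scale (c i) (f i)) = (\<lambda>x. \<Sum>i\<in>A. c i * f i x)"
  by (induction A rule: infinite_finite_induct)
     (auto simp: complex_fun_scale_def fun_eq_iff)

lemma laguerre_space_eq:
  "laguerre_space N = range (\<lambda>c x. \<Sum>n\<le>N. c n * laguerre_fun n x)"
proof -
  interpret vector_space complex_fun_scale
    by (rule vector_space_complex_fun_scale)
  show ?thesis
  proof (intro equalityI subsetI)
    fix f assume "f \<in> laguerre_space N"
    then have "f \<in> span (laguerre_fun ` {..N})"
      by (simp add: laguerre_space_def)
    then show "f \<in> range (\<lambda>c x. \<Sum>n\<le>N. c n * laguerre_fun n x)"
    proof (induction rule: span_induct_alt)
      case base
      show ?case by (rule image_eqI[of _ _ "\<lambda>_. 0"]) (auto simp: fun_eq_iff)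
    next
      case (step a b g)
      then obtain m d where m: "m \<le> N" "b = laguerre_fun m"
        and g: "g = (\<lambda>x. \<Sum>n\<le>N. d n * laguerre_fun n x)" by auto
      have "complex_fun_scale a b + g =
            (\<lambda>x. \<Sum>n\<le>N. (d n + (if n = m then a else 0)) * laguerre_fun n x)"
        using m by (auto simp: fun_eq_iff g complex_fun_scale_def distrib_right sum.distrib
            if_distrib[of "\<lambda>z. z * _"] cong: if_cong)
      then show ?case
        by (rule image_eqI[of _ _ "\<lambda>n. d n + (if n = m then a else 0)"]) simp
    qed
  next
    fix f assume "f \<in> range (\<lambda>c x. \<Sum>n\<le>N. c n * laguerre_fun n x)"
    then obtain c where "f = (\<Sum>n\<le>N. complex_fun_scale (c n) (laguerre_fun n))"
      by (auto simp: sum_complex_fun_scale_apply)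
    then show "f \<in> laguerre_space N"
      by (auto simp: laguerre_space_def intro!: span_sum span_scale intro: span_base)
  qed
qed

definition spherical_hankel :: "nat \<Rightarrow> complex \<Rightarrow> complex" where
  "spherical_hankel \<nu> z =
     - (\<i> / z) * exp (\<i> * z) * (- \<i>) ^ \<nu> *
     (\<Sum>m\<le>\<nu>. \<i> ^ m / (fact m * (2 * z) ^ m) * (fact (\<nu> + m) / fact (\<nu> - m)))"

end

theory Submission
  imports Defs "HOL-Probability.Distributions"
begin

text \<open>
  Put \<open>a = R / \<sigma>\<close>, \<open>b = \<surd>a\<close> and \<open>s = -\<i>\<sigma>\<omega>\<close>. The Hankel function is a linear combination of the functions
  \<open>e\<^bsup>-s\<xi>\<^esup> / (\<xi> + a)\<^bsup>m+1\<^esup>\<close> with \<open>m \<le> \<nu>\<close>, and integrating along the ray through \<open>1 / b\<close>,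
  \<open>m! b\<^bsup>m+1\<^esup> / (\<xi> + a)\<^bsup>m+1\<^esup> = \<integral>\<^sub>0\<^sup>\<infinity> r\<^sup>m e\<^bsup>-r(\<xi>+a)/b\<^esup> dr\<close>.
  So the function to be approximated is a superposition of exponentials \<open>e\<^bsup>-p\<xi>\<^esup>\<close> with \<open>p = s + r / b\<close>.
  The Laguerre projection of a single exponential has the exact error
  \<open>\<bar>(p - 1) / (p + 1)\<bar>\<^bsup>N+1\<^esup> / \<surd>(2 Re p)\<close>, and Minkowski's integral inequality bounds the total error by the
  integral of these errors against \<open>r\<^sup>m e\<^bsup>-r Re b\<^esup>\<close>. By the choice of the ray the exponent is, up to
  bounded terms, \<open>- Re b (r + 2(N+1)/r)\<close>, with the saddle point \<open>r = \<surd>(2(N+1))\<close>; a Gaussian bound near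
  it gives the second term of the claim. The first term is never needed: it decays
  geometrically in \<open>N\<close>, hence faster than the second.
\<close>

subsection \<open>Laplace transforms of powers on the half line\<close>

text \<open>In norm the integrand is a constant multiple of the Erlang density with rate
  \<open>Re z\<close>.\<close>

lemma integrable_power_exp_half_line:
  fixes z :: complex
  assumes "Re z > 0"
  shows "integrable lborel (\<lambda>x::real. indicat_real {0..} x *\<^sub>R (of_real x ^ k * exp (- (z * of_real x))))"
proof -
  have "(\<integral>\<^sup>+ x. ennreal (erlang_density k (Re z) x * x ^ 0) \<partial>lborel) < \<infinity>"
    by (subst nn_integral_erlang_ith_moment[OF assms]) auto
  then have "integrable lborel (erlang_density k (Re z))"
    using assms by (intro integrableI_nonneg) auto
  then have "integrable lborel (\<lambda>x. (fact k / Re z ^ Suc k) * erlang_density k (Re z) x)"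
    by simp
  then show ?thesis
    by (rule Bochner_Integration.integrable_bound)
       (use assms in \<open>auto simp: erlang_density_def norm_mult norm_power split: split_indicator\<close>)
qed

text \<open>On [0, T] this is the usual fundamental theorem; integrability identifies the limit of
  the truncated integrals. It replaces explicit integration by parts in the induction below.\<close>

lemma integral_half_line_FTC:
  fixes F f :: "real \<Rightarrow> complex"
  assumes deriv: "\<And>x. (F has_vector_derivative f x) (at x)"
    and cont: "continuous_on UNIV f"
    and int: "integrable lborel (\<lambda>x. indicat_real {0..} x *\<^sub>R f x)"
    and lim: "(F \<longlongrightarrow> 0) at_top"
  shows "(\<integral>x. indicat_real {0..} x *\<^sub>R f x \<partial>lborel) = - F 0"
proof (rule tendsto_unique[OF trivial_limit_at_top_linorder])
  have "((\<lambda>T. \<integral>x. indicat_real {..T} x *\<^sub>R (indicat_real {0..} x *\<^sub>R f x) \<partial>lborel) \<longlongrightarrow>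
          (\<integral>x. indicat_real {0..} x *\<^sub>R f x \<partial>lborel)) at_top"
    using int by (intro tendsto_integral_at_top) auto
  moreover have "eventually (\<lambda>T. (\<integral>x. indicat_real {..T} x *\<^sub>R (indicat_real {0..} x *\<^sub>R f x) \<partial>lborel)
      = F T - F 0) at_top"
    using eventually_ge_at_top[of 0]
  proof eventually_elim
    case (elim T)
    have "(\<integral>x. indicat_real {..T} x *\<^sub>R (indicat_real {0..} x *\<^sub>R f x) \<partial>lborel) =
          (\<integral>x. indicat_real {0..T} x *\<^sub>R f x \<partial>lborel)"
      by (intro Bochner_Integration.integral_cong) (auto split: split_indicator)
    also have "\<dots> = F T - F 0"
      using elim by (intro integral_FTC_atLeastAtMost has_vector_derivative_at_within[OF deriv]
          continuous_on_subset[OF cont]) auto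
    finally show ?case .
  qed
  ultimately show "((\<lambda>T. F T - F 0) \<longlongrightarrow> (\<integral>x. indicat_real {0..} x *\<^sub>R f x \<partial>lborel)) at_top"
    by (rule Lim_transform_eventually)
  show "((\<lambda>T. F T - F 0) \<longlongrightarrow> - F 0) at_top"
    using tendsto_diff[OF lim tendsto_const[of "F 0"]] by simp
qed

lemma tendsto_power_exp_complex:
  fixes z :: complex
  assumes "Re z > 0"
  shows "((\<lambda>x::real. of_real x ^ k * exp (- (z * of_real x))) \<longlongrightarrow> 0) at_top"
proof (rule Lim_null_comparison)
  have "((\<lambda>x. (1 / Re z ^ k) * ((Re z * x) ^ k / exp (Re z * x))) \<longlongrightarrow> (1 / Re z ^ k) * 0) at_top"
    by (intro tendsto_intros filterlim_compose[OF tendsto_power_div_exp_0]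
        filterlim_tendsto_pos_mult_at_top[OF tendsto_const assms filterlim_ident])
  then show "((\<lambda>x. x ^ k * exp (- (Re z * x))) \<longlongrightarrow> 0) at_top"
    using assms by (simp add: exp_minus field_simps)
  show "\<forall>\<^sub>F x in at_top. cmod (of_real x ^ k * exp (- (z * of_real x))) \<le> x ^ k * exp (- (Re z * x))"
    using eventually_ge_at_top[of "0::real"]
    by eventually_elim (auto simp: norm_mult norm_power)
qed

text \<open>Induction on \<open>k\<close>: integrating the derivative of x^(k+1) e^(-zx) gives (k+1)
  I(k) = z I(k+1), since both boundary terms vanish. Because \<open>z\<close> may be complex, no
  contour has to be rotated later.\<close>

lemma has_bochner_integral_power_exp:
  fixes z :: complex
  assumes z: "Re z > 0"
  shows "has_bochner_integral lborel
    (\<lambda>x::real. indicat_real {0..} x *\<^sub>R (of_real x ^ k * exp (- (z * of_real x)))) (fact k / z ^ Suc k)"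
proof -
  define I where "I k = (\<integral>x. indicat_real {0..} x *\<^sub>R (of_real x ^ k * exp (- (z * of_real x))) \<partial>lborel)"
    for k
  note integrable = integrable_power_exp_half_line[OF z]
  have z0: "z \<noteq> 0" using z by auto
  have "I k = fact k / z ^ Suc k"
  proof (induction k)
    case 0
    have D: "((\<lambda>x. exp (- (z * of_real x))) has_vector_derivative - z * exp (- (z * of_real x))) (at x)"
      for x :: real
      by (rule has_vector_derivative_real_field) (auto intro!: derivative_eq_intros)
    have int: "integrable lborel (\<lambda>x. indicat_real {0..} x *\<^sub>R (- z * exp (- (z * of_real x))))"
      using integrable_mult_right[OF integrable[of 0], of "- z"]
      by (simp add: scaleR_conv_of_real mult_ac)
    have "(\<integral>x. indicat_real {0..} x *\<^sub>R (- z * exp (- (z * of_real x))) \<partial>lborel) = - exp (- (z * of_real 0))"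
      using tendsto_power_exp_complex[OF z, of 0]
      by (intro integral_half_line_FTC D int continuous_intros) simp
    moreover have "(\<integral>x. indicat_real {0..} x *\<^sub>R (- z * exp (- (z * of_real x))) \<partial>lborel) = - z * I 0"
      unfolding I_def by (subst integral_mult_right_zero[symmetric]) (simp add: scaleR_conv_of_real mult_ac)
    ultimately show ?case
      using z0 by (simp add: field_simps)
  next
    case (Suc k)
    have D: "((\<lambda>x. of_real x ^ Suc k * exp (- (z * of_real x))) has_vector_derivative
            of_nat (Suc k) * (of_real x ^ k * exp (- (z * of_real x))) -
              z * (of_real x ^ Suc k * exp (- (z * of_real x)))) (at x)" for x :: real
      by (rule has_vector_derivative_real_field)
         (auto intro!: derivative_eq_intros simp: algebra_simps power_eq_if[of "of_real x :: complex" k])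
    have int: "has_bochner_integral lborel (\<lambda>x::real. indicat_real {0..} x *\<^sub>R
            (of_nat (Suc k) * (of_real x ^ k * exp (- (z * of_real x))) -
              z * (of_real x ^ Suc k * exp (- (z * of_real x)))))
         (of_nat (Suc k) * I k - z * I (Suc k))"
    proof -
      have h: "has_bochner_integral lborel
         (\<lambda>x::real. of_nat (Suc k) * (indicat_real {0..} x *\<^sub>R (of_real x ^ k * exp (- (z * of_real x)))) -
            z * (indicat_real {0..} x *\<^sub>R (of_real x ^ Suc k * exp (- (z * of_real x)))))
         (of_nat (Suc k) * I k - z * I (Suc k))"
        unfolding I_def
        by (intro has_bochner_integral_diff has_bochner_integral_mult_right has_bochner_integral_integrable integrable)
      show ?thesis
        by (rule has_bochner_integral_cong[THEN iffD1, OF refl _ refl h]) (auto split: split_indicator)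
    qed
    have "(\<integral>x. indicat_real {0..} x *\<^sub>R
            (of_nat (Suc k) * (of_real x ^ k * exp (- (z * of_real x))) -
              z * (of_real x ^ Suc k * exp (- (z * of_real x)))) \<partial>lborel) = - (of_real 0 ^ Suc k * exp (- (z * of_real 0)))"
      by (intro integral_half_line_FTC D tendsto_power_exp_complex[OF z] continuous_intros
          integrable.intros[OF int])
    then have "of_nat (Suc k) * I k = z * I (Suc k)"
      using has_bochner_integral_integral_eq[OF int] by simp
    then show ?case
      using Suc.IH z0 by (simp add: field_simps)
  qed
  then show ?thesis
    using has_bochner_integral_integrable[OF integrable[of k]] by (simp add: I_def)
qed

text \<open>Up to sign, an \<open>n\<close>-th finite difference in \<open>a\<close> of the
  polynomial \<open>a choose k\<close> of degree \<open>k\<close>. By Pascal's rule one difference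
  lowers \<open>n\<close> and \<open>k\<close> together by one, so it vanishes for k < n.\<close>

lemma alternating_sum_choose:
  "(\<Sum>j\<le>n. (- 1) ^ j * of_nat (n choose j) * of_nat ((a + j) choose k)) =
     (if k < n then 0 else (- 1) ^ n * (of_nat (a choose (k - n)) :: 'a :: comm_ring_1))"
proof (induction n arbitrary: a k)
  case 0
  show ?case by simp
next
  case (Suc n)
  define T where "T n a k = (\<Sum>j\<le>n. (- 1) ^ j * of_nat (n choose j) * (of_nat ((a + j) choose k) :: 'a))"
    for n a k
  have "T (Suc n) a k = of_nat (a choose k) +
      (\<Sum>j\<le>n. (- 1) ^ Suc j * (of_nat (n choose j) + of_nat (n choose Suc j)) * of_nat ((a + Suc j) choose k))"
    unfolding T_def by (subst sum.atMost_Suc_shift) simp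
  also have "\<dots> = of_nat (a choose k)
      + (\<Sum>j\<le>n. (- 1) ^ Suc j * of_nat (n choose Suc j) * of_nat ((a + Suc j) choose k))
      - T n (Suc a) k"
    unfolding T_def by (simp add: algebra_simps sum.distrib sum_negf sum_subtractf)
  also have "of_nat (a choose k)
      + (\<Sum>j\<le>n. (- 1) ^ Suc j * of_nat (n choose Suc j) * of_nat ((a + Suc j) choose k)) =
      (\<Sum>j\<le>Suc n. (- 1) ^ j * of_nat (n choose j) * (of_nat ((a + j) choose k) :: 'a))"
    by (subst sum.atMost_Suc_shift) simp
  also have "\<dots> = T n a k"
    by (simp add: T_def binomial_eq_0)
  finally have rec: "T (Suc n) a k = T n a k - T n (Suc a) k" .
  show ?case
  proof (cases k)
    case 0
    with rec show ?thesis by (simp add: T_def)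
  next
    case (Suc k')
    have "T n (Suc a) k = T n a k + T n a k'"
      unfolding T_def Suc by (simp add: algebra_simps sum.distrib)
    with rec have "T (Suc n) a k = - T n a k'" by simp
    also have "\<dots> = (if k < Suc n then 0 else (- 1) ^ Suc n * of_nat (a choose (k - Suc n)))"
      unfolding T_def Suc.IH using Suc by auto
    finally show ?thesis unfolding T_def .
  qed
qed

subsection \<open>Laguerre functions and exponentials\<close>

lemma laguerre_fun_altdef:
  "laguerre_fun n x = (\<Sum>k\<le>n. of_nat (n choose k) * (- 2) ^ k / fact k * (of_real x ^ k * exp (- of_real x)))"
proof -
  have "laguerre_poly n (2 * x) = (\<Sum>k\<le>n. of_nat (n choose k) * (- 2) ^ k / fact k * x ^ k)"
    unfolding laguerre_poly_def by (intro sum.cong refl) (simp flip: power_mult_distrib add: field_simps)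
  then show ?thesis
    by (simp add: laguerre_fun_def exp_of_real[symmetric] sum_distrib_left mult_ac)
qed

lemma cnj_laguerre_fun [simp]: "cnj (laguerre_fun n x) = laguerre_fun n x"
  by (simp add: laguerre_fun_def)

text \<open>Common source of two closed forms: k = 0 gives the Laplace transform of
  \<open>laguerre_fun n\<close>, z = 1 its moments against e^(-x). The factor e^(-x) inside
  \<open>laguerre_fun\<close> shifts \<open>z\<close> to z + 1.\<close>

lemma has_bochner_integral_power_exp_laguerre_fun:
  assumes z: "Re z > -1"
  shows "has_bochner_integral lborel
    (\<lambda>x. indicat_real {0..} x *\<^sub>R (of_real x ^ k * exp (- (z * of_real x)) * laguerre_fun n x))
    (\<Sum>j\<le>n. of_nat (n choose j) * (- 2) ^ j / fact j * (fact (k + j) / (z + 1) ^ Suc (k + j)))"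
proof -
  have "has_bochner_integral lborel
    (\<lambda>x. \<Sum>j\<le>n. of_nat (n choose j) * (- 2) ^ j / fact j *
       (indicat_real {0..} x *\<^sub>R (of_real x ^ (k + j) * exp (- ((z + 1) * of_real x)))))
    (\<Sum>j\<le>n. of_nat (n choose j) * (- 2) ^ j / fact j * (fact (k + j) / (z + 1) ^ Suc (k + j)))"
    by (intro has_bochner_integral_sum has_bochner_integral_mult_right has_bochner_integral_power_exp)
       (use z in auto)
  moreover have "exp (- ((z + 1) * of_real x)) = exp (- (z * of_real x)) * exp (- of_real x)" for x
    by (simp add: exp_add[symmetric] algebra_simps)
  ultimately show ?thesis
    by (simp add: laguerre_fun_altdef sum_distrib_left scaleR_conv_of_real power_add mult_ac)
qed

text \<open>For k = 0 the factorials cancel and the sum is the binomial expansion of (1 -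
  2/(z+1))^n. These integrals yield the Laguerre coefficients of an exponential.\<close>

lemma has_bochner_integral_exp_laguerre_fun:
  assumes z: "Re z > -1"
  shows "has_bochner_integral lborel
    (\<lambda>x. indicat_real {0..} x *\<^sub>R (exp (- (z * of_real x)) * laguerre_fun n x))
    (((z - 1) / (z + 1)) ^ n / (z + 1))"
proof -
  have nz: "z + 1 \<noteq> 0" using z by (auto simp: complex_eq_iff)
  have "((z - 1) / (z + 1)) ^ n = (- 2 / (z + 1) + 1) ^ n"
    using nz by (simp add: field_simps)
  also have "\<dots> / (z + 1) =
      (\<Sum>j\<le>n. of_nat (n choose j) * (- 2) ^ j / fact j * (fact (0 + j) / (z + 1) ^ Suc (0 + j)))"
  proof (subst binomial_ring, subst sum_divide_distrib, intro sum.cong refl)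
    show "of_nat (n choose j) * (- 2 / (z + 1)) ^ j * 1 ^ (n - j) / (z + 1) =
        of_nat (n choose j) * (- 2) ^ j / fact j * (fact (0 + j) / (z + 1) ^ Suc (0 + j))" for j
      unfolding power_divide by simp
  qed
  finally show ?thesis
    using has_bochner_integral_power_exp_laguerre_fun[OF z, of 0 n] by simp
qed

lemma has_bochner_integral_power_exp_one_laguerre_fun:
  "has_bochner_integral lborel
    (\<lambda>x. indicat_real {0..} x *\<^sub>R (of_real x ^ k * exp (- of_real x) * laguerre_fun n x))
    ((- 1) ^ n * fact k * of_nat (k choose n) / 2 ^ Suc k)"
proof -
  \<comment> \<open>Since (k+j)!/j! is k! times a binomial coefficient, the sum is the alternating
    sum above with a = k.\<close>
  have "(\<Sum>j\<le>n. of_nat (n choose j) * (- 2) ^ j / fact j * (fact (k + j) / (1 + 1) ^ Suc (k + j))) =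
        (fact k / 2 ^ Suc k) *
        (\<Sum>j\<le>n. (- 1) ^ j * of_nat (n choose j) * (of_nat ((k + j) choose k) :: complex))"
    unfolding sum_distrib_left
  proof (intro sum.cong refl)
    fix j
    have "(of_nat ((k + j) choose k) :: complex) = fact (k + j) / (fact k * fact j)"
      by (simp add: binomial_fact)
    moreover have "(- 2 :: complex) ^ j = (- 1) ^ j * 2 ^ j"
      by (simp flip: power_mult_distrib)
    ultimately show "of_nat (n choose j) * (- 2) ^ j / fact j * (fact (k + j) / (1 + 1) ^ Suc (k + j)) =
      fact k / 2 ^ Suc k * ((- 1) ^ j * of_nat (n choose j) * (of_nat ((k + j) choose k) :: complex))"
      by (simp add: power_add field_simps)
  qed
  also have "\<dots> = (- 1) ^ n * fact k * of_nat (k choose n) / 2 ^ Suc k"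
    by (simp add: alternating_sum_choose binomial_symmetric[symmetric] binomial_eq_0)
  finally show ?thesis
    using has_bochner_integral_power_exp_laguerre_fun[of 1 k n] by simp
qed

text \<open>Only the factor of lower index is expanded: its moments of order k < n against
  \<open>laguerre_fun n\<close> vanish, so a term survives only for k = m = n. The value 1/2 instead
  of 1 comes from the argument 2x.\<close>

lemma laguerre_fun_orthogonal:
  assumes "m \<le> n"
  shows "has_bochner_integral lborel (\<lambda>x. indicat_real {0..} x *\<^sub>R (laguerre_fun m x * laguerre_fun n x))
    (if m = n then 1 / 2 else 0)"
proof -
  have "has_bochner_integral lborel
    (\<lambda>x. \<Sum>k\<le>m. of_nat (m choose k) * (- 2) ^ k / fact k *
      (indicat_real {0..} x *\<^sub>R (of_real x ^ k * exp (- of_real x) * laguerre_fun n x)))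
    (\<Sum>k\<le>m. of_nat (m choose k) * (- 2) ^ k / fact k * ((- 1) ^ n * fact k * of_nat (k choose n) / 2 ^ Suc k))"
    by (intro has_bochner_integral_sum has_bochner_integral_mult_right
        has_bochner_integral_power_exp_one_laguerre_fun)
  also have "(\<lambda>x. \<Sum>k\<le>m. of_nat (m choose k) * (- 2) ^ k / fact k *
      (indicat_real {0..} x *\<^sub>R (of_real x ^ k * exp (- of_real x) * laguerre_fun n x))) =
    (\<lambda>x. indicat_real {0..} x *\<^sub>R (laguerre_fun m x * laguerre_fun n x))"
    by (rule ext)
       (simp add: laguerre_fun_altdef[of m] sum_distrib_right sum_distrib_left scaleR_conv_of_real mult_ac)
  also have "(\<Sum>k\<le>m. of_nat (m choose k) * (- 2) ^ k / fact k *
      ((- 1) ^ n * fact k * of_nat (k choose n) / 2 ^ Suc k)) =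
    (\<Sum>k\<le>m. if k = n then (1 / 2 :: complex) else 0)"
  proof (intro sum.cong refl)
    fix k assume "k \<in> {..m}"
    with assms have "k \<le> n" "k = n \<Longrightarrow> m = n" by auto
    moreover have "(- 2 :: complex) ^ k = (- 1) ^ k * 2 ^ k"
      by (simp flip: power_mult_distrib)
    ultimately show "of_nat (m choose k) * (- 2) ^ k / fact k *
        ((- 1) ^ n * fact k * of_nat (k choose n) / 2 ^ Suc k) = (if k = n then (1 / 2 :: complex) else 0)"
      by (auto simp: binomial_eq_0 simp flip: power_mult_distrib)
  qed
  also have "\<dots> = (if m = n then 1 / 2 else 0)"
    using assms by auto
  finally show ?thesis .
qed

section \<open>Exact projection error of a single exponential\<close>

lemma one_minus_norm_cayley_squared:
  assumes "p \<noteq> -1"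
  shows "1 - (cmod ((p - 1) / (p + 1)))\<^sup>2 = 4 * Re p / (cmod (p + 1))\<^sup>2"
proof -
  have "p + 1 \<noteq> 0" using assms by (metis add.right_cancel add.left_inverse)
  then have "(cmod (p + 1))\<^sup>2 \<noteq> 0" by simp
  \<comment> \<open>This identity is why p -> (p-1)/(p+1) maps the right half plane into the unit
    disc.\<close>
  moreover have eq: "4 * Re p = (cmod (p + 1))\<^sup>2 - (cmod (p - 1))\<^sup>2"
    unfolding cmod_power2 by (simp add: power2_eq_square algebra_simps)
  ultimately show ?thesis
    unfolding norm_divide power_divide eq by (simp add: diff_divide_distrib)
qed

text \<open>The sum is the orthogonal projection of the exponential: each coefficient is the
  integral against \<open>laguerre_fun n\<close> divided by the squared norm 1/2. \<open>M\<close>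
  counts the terms, so the space of index N corresponds to M = N + 1.\<close>

definition exp_laguerre_remainder :: "nat \<Rightarrow> complex \<Rightarrow> real \<Rightarrow> complex" where
  "exp_laguerre_remainder M p x =
     exp (- (p * of_real x)) - (\<Sum>n<M. 2 / (p + 1) * ((p - 1) / (p + 1)) ^ n * laguerre_fun n x)"

lemma has_bochner_integral_remainder_laguerre_fun:
  assumes p: "Re p > 0"  and "M \<le> m"
  shows "has_bochner_integral lborel
    (\<lambda>x. indicat_real {0..} x *\<^sub>R (exp_laguerre_remainder M p x * laguerre_fun m x))
    (((p - 1) / (p + 1)) ^ m / (p + 1))"
proof -
  have "has_bochner_integral lborel
    (\<lambda>x. indicat_real {0..} x *\<^sub>R (exp (- (p * of_real x)) * laguerre_fun m x) -
       (\<Sum>n<M. 2 / (p + 1) * ((p - 1) / (p + 1)) ^ n * (indicat_real {0..} x *\<^sub>R (laguerre_fun n x * laguerre_fun m x))))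
    (((p - 1) / (p + 1)) ^ m / (p + 1) - (\<Sum>n<M. 2 / (p + 1) * ((p - 1) / (p + 1)) ^ n * (if n = m then 1 / 2 else 0)))"
    using assms by (intro has_bochner_integral_diff has_bochner_integral_sum has_bochner_integral_mult_right
        has_bochner_integral_exp_laguerre_fun laguerre_fun_orthogonal) auto
  also have "(\<Sum>n<M. 2 / (p + 1) * ((p - 1) / (p + 1)) ^ n * (if n = m then 1 / 2 else 0)) = 0"
    using assms by (intro sum.neutral) auto
  finally show ?thesis
    by (simp add: exp_laguerre_remainder_def scaleR_conv_of_real left_diff_distrib right_diff_distrib
        sum_distrib_left sum_distrib_right mult_ac)
qed

text \<open>Induction on \<open>M\<close> gives the exact error without completeness of the Laguerre
  functions: subtracting the next term multiplies the squared norm by the squared modulus of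
  (p-1)/(p+1).\<close>

lemma has_bochner_integral_norm_remainder_squared:
  assumes p: "Re p > 0"
  shows "has_bochner_integral lborel
    (\<lambda>x. indicat_real {0..} x * (cmod (exp_laguerre_remainder M p x))\<^sup>2)
    (cmod ((p - 1) / (p + 1)) ^ (2 * M) / (2 * Re p))"
proof (induction M)
  case 0
  have "has_bochner_integral lborel (\<lambda>x. indicat_real {0..} x *\<^sub>R
      (of_real x ^ 0 * exp (- (of_real (2 * Re p) * of_real x)))) (fact 0 / complex_of_real (2 * Re p) ^ Suc 0)"
    by (rule has_bochner_integral_power_exp) (use p in auto)
  from has_bochner_integral_Re[OF this] show ?case
    by (simp add: exp_laguerre_remainder_def scaleR_conv_of_real Re_exp exp_double[symmetric] mult_ac)
next
  case (Suc M)
  define q where "q = (p - 1) / (p + 1)"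
  define c where "c = 2 / (p + 1) * q ^ M"
  have nz: "p \<noteq> - 1" using p by auto
  have c2: "(cmod c)\<^sup>2 = 4 / (cmod (p + 1))\<^sup>2 * cmod q ^ (2 * M)"
    by (simp add: c_def norm_mult norm_divide norm_power power_mult_distrib power_divide
        power_mult[of _ M 2] mult.commute[of 2 M])
  \<comment> \<open>Expansion of the square of u - c l; it uses that the Laguerre function l is
    real.\<close>
  have rec: "(cmod (exp_laguerre_remainder (Suc M) p x))\<^sup>2 = (cmod (exp_laguerre_remainder M p x))\<^sup>2 -
      2 * Re (cnj c * (exp_laguerre_remainder M p x * laguerre_fun M x)) +
      (cmod c)\<^sup>2 * Re (laguerre_fun M x * laguerre_fun M x)" for x
  proof -
    have "exp_laguerre_remainder (Suc M) p x = exp_laguerre_remainder M p x - c * laguerre_fun M x"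
      by (simp add: exp_laguerre_remainder_def c_def q_def)
    moreover have "laguerre_fun M x = of_real (Re (laguerre_fun M x))"
      by (simp add: laguerre_fun_def)
    moreover have "(cmod (u - c * of_real r))\<^sup>2 = (cmod u)\<^sup>2 - 2 * Re (cnj c * (u * of_real r)) +
        (cmod c)\<^sup>2 * Re (of_real r * of_real r)" for u and r :: real
      unfolding cmod_power2 by (simp add: power2_eq_square algebra_simps)
    ultimately show ?thesis by metis
  qed
  have "has_bochner_integral lborel
    (\<lambda>x. indicat_real {0..} x * (cmod (exp_laguerre_remainder M p x))\<^sup>2 -
      2 * Re (cnj c * (indicat_real {0..} x *\<^sub>R (exp_laguerre_remainder M p x * laguerre_fun M x))) +
      (cmod c)\<^sup>2 * Re (indicat_real {0..} x *\<^sub>R (laguerre_fun M x * laguerre_fun M x)))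
    (cmod ((p - 1) / (p + 1)) ^ (2 * M) / (2 * Re p) - 2 * Re (cnj c * (q ^ M / (p + 1))) + (cmod c)\<^sup>2 * Re (1 / 2))"
    using has_bochner_integral_remainder_laguerre_fun[OF p, of M M] laguerre_fun_orthogonal[of M M]
    by (intro has_bochner_integral_add has_bochner_integral_diff has_bochner_integral_mult_right
        has_bochner_integral_Re Suc.IH) (simp_all add: q_def)
  \<comment> \<open>The coefficient \<open>c\<close> is twice the inner product, so the cross term
    removes |c|^2 while the last term returns |c|^2/2.\<close>
  also have "cnj c * (q ^ M / (p + 1)) = of_real ((cmod c)\<^sup>2 / 2)"
  proof -
    define d where "d = q ^ M / (p + 1)"
    have "c = 2 * d" by (simp add: c_def d_def)
    then have "d = c / 2" by simp
    then show ?thesis unfolding d_def[symmetric] using complex_norm_square[of c] by (simp add: mult.commute)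
  qed
  also have "cmod ((p - 1) / (p + 1)) ^ (2 * M) / (2 * Re p) - 2 * Re (of_real ((cmod c)\<^sup>2 / 2)) + (cmod c)\<^sup>2 * Re (1 / 2)
     = cmod q ^ (2 * M) / (2 * Re p) * (1 - 4 * Re p / (cmod (p + 1))\<^sup>2)"
    using p unfolding c2 q_def[symmetric] by (simp add: right_diff_distrib)
  also have "1 - 4 * Re p / (cmod (p + 1))\<^sup>2 = (cmod q)\<^sup>2"
    using one_minus_norm_cayley_squared[OF nz] by (simp add: q_def)
  also have "cmod q ^ (2 * M) / (2 * Re p) * (cmod q)\<^sup>2 = cmod q ^ (2 * Suc M) / (2 * Re p)"
    by (simp add: power2_eq_square)
  also have "(\<lambda>x. indicat_real {0..} x * (cmod (exp_laguerre_remainder M p x))\<^sup>2 -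
      2 * Re (cnj c * (indicat_real {0..} x *\<^sub>R (exp_laguerre_remainder M p x * laguerre_fun M x))) +
      (cmod c)\<^sup>2 * Re (indicat_real {0..} x *\<^sub>R (laguerre_fun M x * laguerre_fun M x)))
    = (\<lambda>x. indicat_real {0..} x * (cmod (exp_laguerre_remainder (Suc M) p x))\<^sup>2)"
    by (auto simp: rec fun_eq_iff split: split_indicator)
  finally show ?case by (simp only: q_def)
qed

subsection \<open>Integral inequalities\<close>

text \<open>Minkowski's integral inequality: the Cauchy--Schwarz inequality is applied to
  the factorization of the integrand as \<open>\<surd>w \<cdot> (F / \<surd>w)\<close>.\<close>
lemma nn_integral_Minkowski_squared:
  fixes F :: "'a \<times> 'b \<Rightarrow> ennreal" and w :: "'a \<Rightarrow> real"
  assumes "sigma_finite_measure M1" "sigma_finite_measure M2"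
    and F [measurable]: "F \<in> borel_measurable (M1 \<Otimes>\<^sub>M M2)"
    and w [measurable]: "w \<in> borel_measurable M1" and nonneg: "\<And>r. 0 \<le> w r"
    and zero: "\<And>r x. w r = 0 \<Longrightarrow> F (r, x) = 0"
    and bound: "\<And>r. (\<integral>\<^sup>+x. (F (r, x))\<^sup>2 \<partial>M2) \<le> ennreal ((w r)\<^sup>2)"
  shows "(\<integral>\<^sup>+x. (\<integral>\<^sup>+r. F (r, x) \<partial>M1)\<^sup>2 \<partial>M2) \<le> (\<integral>\<^sup>+r. ennreal (w r) \<partial>M1)\<^sup>2"
proof -
  interpret pair_sigma_finite M1 M2 using assms by (simp add: pair_sigma_finite_def)
  define W where "W = (\<integral>\<^sup>+r. ennreal (w r) \<partial>M1)"
  define s where "s r = sqrt (w r)" for r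
  have s_nonneg: "s r \<ge> 0" for r using nonneg[of r] by (simp add: s_def)
  have s_zero: "F (r, x) = 0" if "s r = 0" for r x
    using zero that by (simp add: s_def)
  have s_meas [measurable]: "s \<in> borel_measurable M1" unfolding s_def by measurable
  have "(\<integral>\<^sup>+r. F (r, x) \<partial>M1)\<^sup>2 \<le> W * (\<integral>\<^sup>+r. (ennreal (1 / s r) * F (r, x))\<^sup>2 \<partial>M1)"
    if [measurable]: "x \<in> space M2" for x
  proof -
    have "(\<integral>\<^sup>+r. F (r, x) \<partial>M1) = (\<integral>\<^sup>+r. ennreal (s r) * (ennreal (1 / s r) * F (r, x)) \<partial>M1)"
    \<comment> \<open>Where \<open>s r\<close> = 0 the quotient 1 / \<open>s r\<close> is 0 by
      convention, and the hypothesis \<open>zero\<close> makes both sides vanish.\<close>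
    proof (intro nn_integral_cong)
      fix r
      show "F (r, x) = ennreal (s r) * (ennreal (1 / s r) * F (r, x))"
        using s_nonneg[of r] s_zero[of r x]
        by (cases "s r = 0") (simp_all add: mult.assoc[symmetric] ennreal_mult[symmetric])
    qed
    also have "\<dots>\<^sup>2 \<le> (\<integral>\<^sup>+r. (ennreal (s r))\<^sup>2 \<partial>M1) * (\<integral>\<^sup>+r. (ennreal (1 / s r) * F (r, x))\<^sup>2 \<partial>M1)"
      by (intro Cauchy_Schwarz_nn_integral) measurable
    also have "(\<integral>\<^sup>+r. (ennreal (s r))\<^sup>2 \<partial>M1) = W"
      unfolding W_def s_def using nonneg
      by (intro nn_integral_cong) (simp add: ennreal_power)
    finally show ?thesis .
  qed
  then have "(\<integral>\<^sup>+x. (\<integral>\<^sup>+r. F (r, x) \<partial>M1)\<^sup>2 \<partial>M2) \<le>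
      (\<integral>\<^sup>+x. W * (\<integral>\<^sup>+r. (ennreal (1 / s r) * F (r, x))\<^sup>2 \<partial>M1) \<partial>M2)"
    by (intro nn_integral_mono)
  also have "\<dots> = W * (\<integral>\<^sup>+x. (\<integral>\<^sup>+r. (ennreal (1 / s r) * F (r, x))\<^sup>2 \<partial>M1) \<partial>M2)"
    by (intro nn_integral_cmult) measurable
  also have "(\<integral>\<^sup>+x. (\<integral>\<^sup>+r. (ennreal (1 / s r) * F (r, x))\<^sup>2 \<partial>M1) \<partial>M2) =
      (\<integral>\<^sup>+r. (\<integral>\<^sup>+x. (ennreal (1 / s r) * F (r, x))\<^sup>2 \<partial>M2) \<partial>M1)"
    using Fubini[of "\<lambda>(r, x). (ennreal (1 / s r) * F (r, x))\<^sup>2"] by simp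
  \<comment> \<open>After the exchange of integrals the inner one is at most w^2 / w = w, so a
    second factor equal to the integral of \<open>w\<close> appears.\<close>
  also have "\<dots> \<le> (\<integral>\<^sup>+r. ennreal (w r) \<partial>M1)"
  proof (intro nn_integral_mono)
    fix r assume [measurable]: "r \<in> space M1"
    have "(\<integral>\<^sup>+x. (ennreal (1 / s r) * F (r, x))\<^sup>2 \<partial>M2) = (ennreal (1 / s r))\<^sup>2 * (\<integral>\<^sup>+x. (F (r, x))\<^sup>2 \<partial>M2)"
      unfolding power_mult_distrib by (intro nn_integral_cmult) measurable
    also have "\<dots> \<le> (ennreal (1 / s r))\<^sup>2 * ennreal ((w r)\<^sup>2)"
      by (intro mult_left_mono bound) simp
    also have "\<dots> = ennreal (w r)"
      using nonneg[of r]
      by (cases "w r = 0")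
         (simp_all add: ennreal_power ennreal_mult[symmetric] power_divide s_def power2_eq_square[of "w r"])
    finally show "(\<integral>\<^sup>+x. (ennreal (1 / s r) * F (r, x))\<^sup>2 \<partial>M2) \<le> ennreal (w r)" .
  qed
  finally show ?thesis
    by (simp add: W_def power2_eq_square mult_left_mono)
qed

section \<open>Saddle point estimates\<close>

text \<open>The strict inequality \<open>D < L\<close> keeps \<open>\<mu>\<^sup>2 (y - D) / y\<^sup>2\<close> above a multiple of \<open>\<mu>\<close> for \<open>y\<close> much
  smaller than the saddle point \<open>\<mu>\<close>.\<close>
lemma saddle_weight_bound:
  fixes L D \<kappa> :: real
  assumes L: "1 \<le> L" and D: "0 \<le> D" "D < L" and \<kappa>: "0 < \<kappa>"
  obtains C where "C > 0" "\<And>y \<mu>. L \<le> y \<Longrightarrow> 1 \<le> \<mu> \<Longrightarrow>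
    y ^ \<nu> / sqrt y * exp (- \<kappa> * (y + \<mu>\<^sup>2 * (y - D) / y\<^sup>2)) \<le>
      C * exp (- 2 * \<kappa> * \<mu>) *
        (\<mu> ^ \<nu> / sqrt \<mu> * exp (- \<kappa> * (y - \<mu>)\<^sup>2 / (2 * \<mu>)) + y ^ \<nu> * exp (- \<kappa> * y / 4))"
proof -
  \<comment> \<open>\<epsilon> is the minimum of 1 - D/y over y \<ge> L. The choice \<delta> =
    \<epsilon>/3 makes \<mu>^2 (y-D)/y^2 at least 3\<mu> as long as y < \<delta>\<mu>.\<close>
  define \<epsilon> where "\<epsilon> = 1 - D / L"
  define \<delta> where "\<delta> = \<epsilon> / 3"
  have \<epsilon>: "0 < \<epsilon>" "\<epsilon> \<le> 1" using L D by (auto simp: \<epsilon>_def)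
  then have \<delta>: "0 < \<delta>" "\<delta> < 1" by (auto simp: \<delta>_def)
  \<comment> \<open>The exponential absorbs the correction by \<open>D\<close> once y \<ge>
    \<delta>\<mu>; the other factor is the cost of replacing \<open>y\<close> by \<mu> in the
    prefactor when \<delta>\<mu> \<le> y \<le> 2\<mu>.\<close>
  define C where "C = exp (\<kappa> * D / \<delta>\<^sup>2) * (2 ^ \<nu> / sqrt \<delta>)"
  have C1: "C \<ge> exp (\<kappa> * D / \<delta>\<^sup>2)"
  proof -
    have "1 \<le> (2::real) ^ \<nu>" by simp
    moreover have "sqrt \<delta> \<le> 1" using \<delta> by simp
    ultimately have "sqrt \<delta> \<le> 2 ^ \<nu>" by linarith
    then have "1 \<le> 2 ^ \<nu> / sqrt \<delta>" using \<delta> by (simp add: le_divide_eq)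
    from mult_left_mono[OF this, of "exp (\<kappa> * D / \<delta>\<^sup>2)"] show ?thesis by (simp add: C_def)
  qed
  have expD: "exp (\<kappa> * D / \<delta>\<^sup>2) \<ge> 1" using \<kappa> D by simp
  with C1 have "C \<ge> 1" by linarith
  show thesis
  proof (rule that)
    show "C > 0" using \<open>C \<ge> 1\<close> by simp
    fix y \<mu> :: real assume y: "L \<le> y" and \<mu>: "1 \<le> \<mu>"
    have y1: "1 \<le> y" using L y by simp
    define E where "E = y + \<mu>\<^sup>2 * (y - D) / y\<^sup>2"
    define A where "A = \<mu> ^ \<nu> / sqrt \<mu> * exp (- \<kappa> * (y - \<mu>)\<^sup>2 / (2 * \<mu>))"
    define B where "B = y ^ \<nu> * exp (- \<kappa> * y / 4)"
    have AB: "0 \<le> A" "0 \<le> B" using y1 \<mu> by (auto simp: A_def B_def)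
    have sy: "y ^ \<nu> / sqrt y \<le> y ^ \<nu>" using y1 by (simp add: divide_le_eq mult_le_cancel_left1)
    \<comment> \<open>Three ranges: y < \<delta>\<mu> and y > 2\<mu> are dominated by the tail
      \<open>B\<close>, the range between them by the Gaussian \<open>A\<close>.\<close>
    have "y ^ \<nu> / sqrt y * exp (- \<kappa> * E) \<le> C * exp (- 2 * \<kappa> * \<mu>) * A \<or>
          y ^ \<nu> / sqrt y * exp (- \<kappa> * E) \<le> C * exp (- 2 * \<kappa> * \<mu>) * B"
    proof (cases "y < \<delta> * \<mu>")
      case True
      have "\<epsilon> \<le> 1 - D / y" using y L D by (auto simp: \<epsilon>_def intro!: divide_left_mono)
      have "3 * \<mu> * y \<le> \<mu>\<^sup>2 * \<epsilon>"
        using True \<mu> by (simp add: \<delta>_def power2_eq_square field_simps)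
      also have "\<dots> \<le> \<mu>\<^sup>2 * (1 - D / y)"
        using \<open>\<epsilon> \<le> 1 - D / y\<close> by (intro mult_left_mono) auto
      finally have "3 * \<mu> \<le> \<mu>\<^sup>2 * (1 - D / y) / y"
        using y1 by (simp add: le_divide_eq)
      also have "\<dots> = \<mu>\<^sup>2 * (y - D) / y\<^sup>2"
        using y1 by (simp add: field_simps power2_eq_square)
      finally have "E \<ge> 2 * \<mu> + y / 4"
        using \<mu> y1 by (simp add: E_def)
      then have "exp (- \<kappa> * E) \<le> exp (- 2 * \<kappa> * \<mu> + - \<kappa> * y / 4)"
        using mult_left_mono[of "2 * \<mu> + y / 4" E \<kappa>] \<kappa> by (simp add: algebra_simps)
      also have "\<dots> = exp (- 2 * \<kappa> * \<mu>) * exp (- \<kappa> * y / 4)" by (rule exp_add)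
      finally have "y ^ \<nu> / sqrt y * exp (- \<kappa> * E) \<le> y ^ \<nu> * (exp (- 2 * \<kappa> * \<mu>) * exp (- \<kappa> * y / 4))"
        using sy y1 by (intro mult_mono) auto
      also have "\<dots> = 1 * exp (- 2 * \<kappa> * \<mu>) * B" by (simp add: B_def)
      also have "\<dots> \<le> C * exp (- 2 * \<kappa> * \<mu>) * B"
        using \<open>C \<ge> 1\<close> AB by (intro mult_right_mono) auto
      finally show ?thesis ..
    next
      case False
      have "\<mu>\<^sup>2 * D / y\<^sup>2 \<le> D / \<delta>\<^sup>2"
      proof -
        have "(\<delta> * \<mu>)\<^sup>2 \<le> y\<^sup>2" using False \<delta> \<mu> by (intro power_mono) auto
        then have "D * (\<delta> * \<mu>)\<^sup>2 \<le> D * y\<^sup>2" using D by (intro mult_left_mono) auto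
        then show ?thesis using \<delta> y1 by (simp add: field_simps)
      qed
      \<comment> \<open>Completing the square in y + \<mu>^2/y exhibits the saddle value 2\<mu> at y
        = \<mu>.\<close>
      moreover have "E = 2 * \<mu> + (y - \<mu>)\<^sup>2 / y - \<mu>\<^sup>2 * D / y\<^sup>2"
        using y1 by (simp add: E_def field_simps power2_eq_square)
      ultimately have E: "E \<ge> 2 * \<mu> + (y - \<mu>)\<^sup>2 / y - D / \<delta>\<^sup>2" by simp
      have expE: "exp (- \<kappa> * E) \<le> exp (\<kappa> * D / \<delta>\<^sup>2) * exp (- 2 * \<kappa> * \<mu>) * exp (- \<kappa> * X)"
        if "X \<le> (y - \<mu>)\<^sup>2 / y" for X
      proof -
        have "2 * \<mu> + X - D / \<delta>\<^sup>2 \<le> E" using E that by simp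
        from mult_left_mono[OF this, of \<kappa>] have "- \<kappa> * E \<le> \<kappa> * D / \<delta>\<^sup>2 + - 2 * \<kappa> * \<mu> + - \<kappa> * X"
          using \<kappa> by (simp add: algebra_simps)
        then have "exp (- \<kappa> * E) \<le> exp (\<kappa> * D / \<delta>\<^sup>2 + - 2 * \<kappa> * \<mu> + - \<kappa> * X)"
          by simp
        then show ?thesis by (simp only: exp_add)
      qed
      show ?thesis
      proof (cases "y \<le> 2 * \<mu>")
        case True
        have "(y - \<mu>)\<^sup>2 / (2 * \<mu>) \<le> (y - \<mu>)\<^sup>2 / y"
          using True y1 by (intro divide_left_mono) auto
        note e = expE[OF this]
        have "sqrt (\<delta> * \<mu>) \<le> sqrt y" using False by simp
        then have "y ^ \<nu> / sqrt y \<le> (2 * \<mu>) ^ \<nu> / sqrt (\<delta> * \<mu>)"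
          using True y1 \<delta> \<mu> by (intro frac_le power_mono) auto
        then have "y ^ \<nu> / sqrt y * exp (- \<kappa> * E) \<le> (2 * \<mu>) ^ \<nu> / sqrt (\<delta> * \<mu>) *
            (exp (\<kappa> * D / \<delta>\<^sup>2) * exp (- 2 * \<kappa> * \<mu>) * exp (- \<kappa> * ((y - \<mu>)\<^sup>2 / (2 * \<mu>))))"
          using e \<delta> \<mu> by (intro mult_mono) auto
        also have "\<dots> = C * exp (- 2 * \<kappa> * \<mu>) * A"
          by (simp add: C_def A_def real_sqrt_mult power_mult_distrib)
        finally show ?thesis ..
      next
        case False
        \<comment> \<open>For y > 2\<mu> the distance to the saddle is at least y/2, so the
          quadratic term is at least y/4.\<close>
        then have "(y / 2)\<^sup>2 \<le> (y - \<mu>)\<^sup>2" using \<mu> by (intro power_mono) auto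
        then have "y / 4 \<le> (y - \<mu>)\<^sup>2 / y"
          using y1 by (simp add: le_divide_eq power2_eq_square)
        note e = expE[OF this]
        have "y ^ \<nu> / sqrt y * exp (- \<kappa> * E) \<le> y ^ \<nu> *
            (exp (\<kappa> * D / \<delta>\<^sup>2) * exp (- 2 * \<kappa> * \<mu>) * exp (- \<kappa> * (y / 4)))"
          using e sy y1 by (intro mult_mono) auto
        also have "\<dots> = exp (\<kappa> * D / \<delta>\<^sup>2) * (exp (- 2 * \<kappa> * \<mu>) * B)"
          by (simp add: B_def)
        also have "\<dots> \<le> C * (exp (- 2 * \<kappa> * \<mu>) * B)"
          using C1 AB by (intro mult_right_mono) auto
        finally show ?thesis by (simp add: mult.assoc)
      qed
    qed
    moreover have "0 \<le> C * exp (- 2 * \<kappa> * \<mu>) * A" "0 \<le> C * exp (- 2 * \<kappa> * \<mu>) * B"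
      using AB \<open>C \<ge> 1\<close> by auto
    ultimately show "y ^ \<nu> / sqrt y * exp (- \<kappa> * (y + \<mu>\<^sup>2 * (y - D) / y\<^sup>2)) \<le>
      C * exp (- 2 * \<kappa> * \<mu>) *
        (\<mu> ^ \<nu> / sqrt \<mu> * exp (- \<kappa> * (y - \<mu>)\<^sup>2 / (2 * \<mu>)) + y ^ \<nu> * exp (- \<kappa> * y / 4))"
      unfolding E_def[symmetric] A_def[symmetric] B_def[symmetric] distrib_left by linarith
  qed
qed

lemma integrable_shifted_power_exp:
  fixes L \<kappa> :: real
  assumes \<kappa>: "0 < \<kappa>" and L: "0 \<le> L"
  shows "integrable lborel (\<lambda>r. indicat_real {0..} r * ((r + L) ^ \<nu> * exp (- \<kappa> * r)))"
proof -
  have "integrable lborel (\<lambda>y. cmod (indicat_real {0..} y *\<^sub>R (of_real y ^ \<nu> * exp (- (of_real \<kappa> * of_real y)))))"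
    using \<kappa> by (intro integrable_norm integrable_power_exp_half_line) simp
  from lborel_integrable_real_affine[OF this, of 1 L]
  have "integrable lborel (\<lambda>r. exp (\<kappa> * L) * cmod (indicat_real {0..} (L + r) *\<^sub>R
      (of_real (L + r) ^ \<nu> * exp (- (of_real \<kappa> * of_real (L + r))))))"
    by simp
  then show ?thesis
  proof (rule Bochner_Integration.integrable_bound, measurable, intro AE_I2)
    fix r :: real
    show "norm (indicat_real {0..} r * ((r + L) ^ \<nu> * exp (- \<kappa> * r))) \<le> norm (exp (\<kappa> * L) *
        cmod (indicat_real {0..} (L + r) *\<^sub>R (of_real (L + r) ^ \<nu> * exp (- (of_real \<kappa> * of_real (L + r))))))"
    proof (cases "0 \<le> r")
      case True
      have "exp (- \<kappa> * r) = exp (\<kappa> * L) * exp (- (\<kappa> * (L + r)))"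
        by (simp add: exp_add[symmetric] algebra_simps)
      with True L show ?thesis
        by (simp add: norm_mult norm_power abs_mult add.commute del: of_real_add)
    qed auto
  qed
qed

text \<open>The Gaussian has variance \<mu>/\<kappa>, so its width of order sqrt \<mu> cancels the
  prefactor 1/sqrt \<mu> and only \<mu>^\<nu> remains. The tail integral \<open>K\<close> does not
  depend on \<mu> and is absorbed because \<mu>^\<nu> \<ge> 1.\<close>

lemma integral_saddle_weight:
  fixes L \<kappa> :: real
  assumes \<kappa>: "0 < \<kappa>" and L: "0 \<le> L"
  obtains C where "C > 0" "\<And>\<mu>. 1 \<le> \<mu> \<Longrightarrow>
    (\<integral>\<^sup>+r. ennreal (indicat_real {0..} r * (\<mu> ^ \<nu> / sqrt \<mu> * exp (- \<kappa> * (r + L - \<mu>)\<^sup>2 / (2 * \<mu>)) +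
         (r + L) ^ \<nu> * exp (- \<kappa> * (r + L) / 4))) \<partial>lborel) \<le> ennreal (C * \<mu> ^ \<nu>)"
proof -
  define K where "K = (\<integral>r. indicat_real {0..} r * ((r + L) ^ \<nu> * exp (- \<kappa> * (r + L) / 4)) \<partial>lborel)"
  have K_int: "integrable lborel (\<lambda>r. indicat_real {0..} r * ((r + L) ^ \<nu> * exp (- \<kappa> * (r + L) / 4)))"
  proof -
    have "integrable lborel (\<lambda>r. exp (- \<kappa> * L / 4) *
        (indicat_real {0..} r * ((r + L) ^ \<nu> * exp (- (\<kappa> / 4) * r))))"
      using \<kappa> L by (intro integrable_mult_right integrable_shifted_power_exp) auto
    moreover have "exp (- \<kappa> * (r + L) / 4) = exp (- \<kappa> * L / 4) * exp (- (\<kappa> / 4) * r)" for r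
      by (simp add: exp_add[symmetric] field_simps)
    ultimately show ?thesis by (simp add: mult_ac)
  qed
  have K_nonneg: "K \<ge> 0"
    unfolding K_def using L by (intro Bochner_Integration.integral_nonneg) (auto split: split_indicator)
  define C where "C = sqrt (2 * pi / \<kappa>) + K"
  show thesis
  proof (rule that)
    show "C > 0" using \<kappa> K_nonneg by (simp add: C_def add_pos_nonneg)
    fix \<mu> :: real assume \<mu>: "1 \<le> \<mu>"
    define G where "G r = \<mu> ^ \<nu> * sqrt (2 * pi / \<kappa>) * normal_density (\<mu> - L) (sqrt (\<mu> / \<kappa>)) r" for r
    have G: "\<mu> ^ \<nu> / sqrt \<mu> * exp (- \<kappa> * (r + L - \<mu>)\<^sup>2 / (2 * \<mu>)) = G r" for r
      using \<mu> \<kappa> by (simp add: G_def normal_density_def real_sqrt_mult real_sqrt_divide power_divide algebra_simps)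
    have "(\<integral>\<^sup>+r. ennreal (indicat_real {0..} r * (\<mu> ^ \<nu> / sqrt \<mu> * exp (- \<kappa> * (r + L - \<mu>)\<^sup>2 / (2 * \<mu>)) +
         (r + L) ^ \<nu> * exp (- \<kappa> * (r + L) / 4))) \<partial>lborel) \<le>
      (\<integral>\<^sup>+r. ennreal (G r + indicat_real {0..} r * ((r + L) ^ \<nu> * exp (- \<kappa> * (r + L) / 4))) \<partial>lborel)"
      using \<mu> \<kappa> unfolding G
      by (intro nn_integral_mono ennreal_leI) (auto simp: G_def split: split_indicator)
    also have "\<dots> = ennreal (\<integral>r. G r + indicat_real {0..} r * ((r + L) ^ \<nu> * exp (- \<kappa> * (r + L) / 4)) \<partial>lborel)"
      using \<mu> \<kappa> L K_int
      by (intro nn_integral_eq_integral AE_I2 Bochner_Integration.integrable_add)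
         (auto simp: G_def intro!: add_nonneg_nonneg mult_nonneg_nonneg split: split_indicator)
    also have "(\<integral>r. G r + indicat_real {0..} r * ((r + L) ^ \<nu> * exp (- \<kappa> * (r + L) / 4)) \<partial>lborel) =
        \<mu> ^ \<nu> * sqrt (2 * pi / \<kappa>) + K"
      using \<mu> \<kappa> K_int unfolding K_def G_def by (subst Bochner_Integration.integral_add) auto
    also have "\<dots> \<le> C * \<mu> ^ \<nu>"
      using \<mu> K_nonneg by (simp add: C_def algebra_simps mult_le_cancel_left1)
    finally show "(\<integral>\<^sup>+r. ennreal (indicat_real {0..} r * (\<mu> ^ \<nu> / sqrt \<mu> * exp (- \<kappa> * (r + L - \<mu>)\<^sup>2 / (2 * \<mu>)) +
         (r + L) ^ \<nu> * exp (- \<kappa> * (r + L) / 4))) \<partial>lborel) \<le> ennreal (C * \<mu> ^ \<nu>)"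
      by (simp add: ennreal_leI order.trans)
  qed
qed

subsection \<open>The error integral\<close>

lemma borel_measurable_laguerre_fun [measurable]: "laguerre_fun n \<in> borel_measurable borel"
proof -
  have "(\<lambda>x. laguerre_fun n x) \<in> borel_measurable borel"
    unfolding laguerre_fun_altdef by measurable
  then show ?thesis by simp
qed

text \<open>Passes from Borel functions and \<open>lborel\<close> to the completed measure on the
  half line. The finite bound also yields membership in \<open>L2_half_line\<close>, without which
  \<open>L2_norm\<close> would be infinite; \<open>g\<close> is a Borel representative of
  \<open>h\<close> there.\<close>

lemma L2_norm_le:
  fixes g :: "real \<Rightarrow> complex"
  assumes [measurable]: "g \<in> borel_measurable borel"
    and bound: "(\<integral>\<^sup>+x. ennreal (indicat_real {0..} x * (cmod (g x))\<^sup>2) \<partial>lborel) \<le> (ennreal W)\<^sup>2"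
    and W: "W \<ge> 0" and eq: "\<And>x. x \<ge> 0 \<Longrightarrow> h x = g x"
  shows "L2_norm h \<le> ereal W"
proof -
  define G where "G x = indicat_real {0..} x * (cmod (g x))\<^sup>2" for x
  have G_meas [measurable]: "G \<in> borel_measurable borel" unfolding G_def by measurable
  have G0: "G x \<ge> 0" for x by (simp add: G_def)
  have fin: "(\<integral>\<^sup>+x. ennreal (G x) \<partial>lborel) < \<infinity>"
    using bound unfolding G_def by (rule le_less_trans) (use W in \<open>simp add: ennreal_power\<close>)
  have int: "integrable lborel G"
    by (rule integrableI_nonneg) (use fin G0 in auto)
  have "ennreal (integral\<^sup>L lborel G) \<le> ennreal (W\<^sup>2)"
    using bound W nn_integral_eq_integral[OF int] G0 by (simp add: G_def ennreal_power)
  then have le: "integral\<^sup>L lborel G \<le> W\<^sup>2" by simp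
  have "integrable lebesgue G" "integral\<^sup>L lebesgue G = integral\<^sup>L lborel G"
    using int by (simp_all add: integrable_completion integral_completion)
  then have "integrable (lebesgue_on {0..}) (\<lambda>x. (cmod (g x))\<^sup>2)"
    "(\<integral>x. (cmod (g x))\<^sup>2 \<partial>lebesgue_on {0..}) = integral\<^sup>L lborel G"
    unfolding G_def[abs_def] by (simp_all add: integrable_restrict_space integral_restrict_space)
  moreover have "integrable (lebesgue_on {0..}) (\<lambda>x. (cmod (g x))\<^sup>2) \<longleftrightarrow>
      integrable (lebesgue_on {0..}) (\<lambda>x. (cmod (h x))\<^sup>2)"
    by (intro Bochner_Integration.integrable_cong) (auto simp: eq)
  moreover have "(\<integral>x. (cmod (g x))\<^sup>2 \<partial>lebesgue_on {0..}) = (\<integral>x. (cmod (h x))\<^sup>2 \<partial>lebesgue_on {0..})"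
    by (intro Bochner_Integration.integral_cong) (auto simp: eq)
  moreover have "h \<in> borel_measurable (lebesgue_on {0..})"
  proof -
    have "g \<in> borel_measurable (lebesgue_on {0..})"
      by (intro measurable_restrict_space1 measurable_completion) simp
    then show ?thesis
      by (rule measurable_cong[THEN iffD1, rotated]) (auto simp: eq)
  qed
  ultimately have "L2_norm h = ereal (sqrt (integral\<^sup>L lborel G))"
    by (simp add: L2_norm_def L2_half_line_def)
  also have "\<dots> \<le> ereal W"
    using real_sqrt_le_mono[OF le] W by simp
  finally show ?thesis .
qed

text \<open>The squared modulus is 1 - 4t with t = Re p / |p+1|^2; apply 1 - 4t \<le> e^(-4t), take
  the root and the power.\<close>

lemma norm_cayley_power_le:
  assumes p: "Re p > 0"
  shows "cmod ((p - 1) / (p + 1)) ^ M \<le> exp (- (2 * real M * (Re p / (cmod (p + 1))\<^sup>2)))"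
proof -
  define t where "t = Re p / (cmod (p + 1))\<^sup>2"
  have "p \<noteq> -1" using p by auto
  from one_minus_norm_cayley_squared[OF this] have "(cmod ((p - 1) / (p + 1)))\<^sup>2 = 1 + - (4 * t)"
    by (simp add: t_def)
  also have "\<dots> \<le> exp (- (4 * t))" by (rule exp_ge_add_one_self)
  also have "\<dots> = (exp (- (2 * t)))\<^sup>2" by (simp add: exp_double[symmetric])
  finally have "cmod ((p - 1) / (p + 1)) \<le> exp (- (2 * t))"
    by (rule power2_le_imp_le) simp
  then have "cmod ((p - 1) / (p + 1)) ^ M \<le> exp (- (2 * t)) ^ M"
    by (intro power_mono) auto
  also have "\<dots> = exp (- (2 * real M * t))"
    by (simp add: exp_of_nat_mult[symmetric] mult_ac)
  finally show ?thesis by (simp add: t_def)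
qed

lemma norm_cayley_le_1:
  assumes "Re p > 0"
  shows "cmod ((p - 1) / (p + 1)) \<le> 1"
proof -
  have "cmod ((p - 1) / (p + 1)) ^ 1 \<le> exp (- (2 * real 1 * (Re p / (cmod (p + 1))\<^sup>2)))"
    using assms by (rule norm_cayley_power_le)
  also have "\<dots> \<le> 1" using assms by simp
  finally show ?thesis by simp
qed

text \<open>In the shifted variable y = r + L the bound of \<open>norm_cayley_power_le\<close> and
  the Laplace factor e^(-\<kappa>r) combine to the exponent of \<open>saddle_weight_bound\<close>
  with \<mu>^2 = 2M.\<close>

lemma laplace_weight_bound:
  fixes b s :: complex
  assumes b: "Re b > 0" and s: "Re s > 0"
  obtains L C where "1 \<le> L" "C > 0" "\<And>M. M \<ge> 1 \<Longrightarrow>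
    (\<integral>\<^sup>+r. ennreal (indicat_real {0..} r * ((r + L) ^ \<nu> * exp (- Re b * r) *
       (cmod ((s + of_real r / b - 1) / (s + of_real r / b + 1)) ^ M / sqrt (2 * Re (s + of_real r / b))))) \<partial>lborel)
    \<le> ennreal (C * exp (- 2 * Re b * sqrt (2 * real M)) * sqrt (2 * real M) ^ \<nu>)"
proof -
  define \<kappa> where "\<kappa> = Re b"
  define B where "B = cmod b"
  \<comment> \<open>With p = s + r/b, these make Re p = (\<kappa>/B^2)(r + s') = (\<kappa>/B^2)(y -
    D) and |p+1| \<le> y/B. The summand 1 ensures L \<ge> 1, and s' > 0 gives D < L.\<close>
  define s' where "s' = Re s * B\<^sup>2 / \<kappa>"
  define L where "L = 1 + s' + B * cmod (s + 1)"
  define D where "D = L - s'"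
  define c where "c = 2 * (\<kappa> / B\<^sup>2) * (s' / L)"
  have \<kappa>: "\<kappa> > 0" and "b \<noteq> 0" using b by (auto simp: \<kappa>_def)
  then have B: "B > 0" by (simp add: B_def)
  have s': "s' > 0" using s \<kappa> B by (simp add: s'_def)
  have L: "1 \<le> L" and D: "0 \<le> D" "D < L" using s' B by (auto simp: L_def D_def)
  have c: "c > 0" using \<kappa> B s' L by (simp add: c_def)
  obtain C1 where C1: "C1 > 0" "\<And>y \<mu>. L \<le> y \<Longrightarrow> 1 \<le> \<mu> \<Longrightarrow>
    y ^ \<nu> / sqrt y * exp (- \<kappa> * (y + \<mu>\<^sup>2 * (y - D) / y\<^sup>2)) \<le>
      C1 * exp (- 2 * \<kappa> * \<mu>) *
        (\<mu> ^ \<nu> / sqrt \<mu> * exp (- \<kappa> * (y - \<mu>)\<^sup>2 / (2 * \<mu>)) + y ^ \<nu> * exp (- \<kappa> * y / 4))"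
    by (rule saddle_weight_bound[OF L D \<kappa>, where \<nu> = \<nu>]) (rule that)
  obtain C2 where C2: "C2 > 0" "\<And>\<mu>. 1 \<le> \<mu> \<Longrightarrow>
    (\<integral>\<^sup>+r. ennreal (indicat_real {0..} r * (\<mu> ^ \<nu> / sqrt \<mu> * exp (- \<kappa> * (r + L - \<mu>)\<^sup>2 / (2 * \<mu>)) +
         (r + L) ^ \<nu> * exp (- \<kappa> * (r + L) / 4))) \<partial>lborel) \<le> ennreal (C2 * \<mu> ^ \<nu>)"
    by (rule integral_saddle_weight[OF \<kappa> order.trans[OF zero_le_one L], where \<nu> = \<nu>]) (rule that)
  define C3 where "C3 = exp (\<kappa> * L) / sqrt c * C1"
  have C3: "C3 > 0" using c C1 by (simp add: C3_def)
  show thesis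
  proof (rule that[OF L])
    show "C3 * C2 > 0" using C3 C2 by simp
    fix M :: nat assume M: "M \<ge> 1"
    define \<mu> where "\<mu> = sqrt (2 * real M)"
    have \<mu>: "1 \<le> \<mu>" "\<mu>\<^sup>2 = 2 * real M" using M by (auto simp: \<mu>_def)
    define W where "W r = \<mu> ^ \<nu> / sqrt \<mu> * exp (- \<kappa> * (r + L - \<mu>)\<^sup>2 / (2 * \<mu>)) +
         (r + L) ^ \<nu> * exp (- \<kappa> * (r + L) / 4)" for r
    define p where "p r = s + of_real r / b" for r :: real
    have le: "(r + L) ^ \<nu> * exp (- \<kappa> * r) * (cmod ((p r - 1) / (p r + 1)) ^ M / sqrt (2 * Re (p r))) \<le>
        C3 * exp (- 2 * \<kappa> * \<mu>) * W r" if r: "r \<ge> 0" for r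
    proof -
      define y where "y = r + L"
      have y: "L \<le> y" "y > 0" using r L by (auto simp: y_def)
      have "Re (of_real r / b) = r * (\<kappa> / B\<^sup>2)"
        by (simp add: Re_divide \<kappa>_def B_def cmod_power2)
      then have Re_p: "Re (p r) = \<kappa> / B\<^sup>2 * (y - D)"
        using \<kappa> B by (simp add: p_def y_def D_def s'_def field_simps)
      \<comment> \<open>As D/L = 1 - s'/L and y \<ge> L, the real part of \<open>p r\<close> grows
        at least linearly in \<open>y\<close>; \<open>c\<close> is the resulting constant in 2 Re p
        \<ge> c y.\<close>
      have yD: "y - D \<ge> s' / L * y"
      proof -
        have "D * L \<le> D * y" using y D by (intro mult_left_mono) auto
        then show ?thesis using L by (simp add: D_def field_simps)
      qed
      then have "y - D > 0" using s' L y by (smt (verit) divide_pos_pos mult_pos_pos)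
      then have Re_p_pos: "Re (p r) > 0" using \<kappa> B by (simp add: Re_p)
      have "cmod (p r + 1) = cmod ((s + 1) + of_real r / b)" by (simp add: p_def algebra_simps)
      also have "\<dots> \<le> cmod (s + 1) + r / B"
        using norm_triangle_ineq[of "s + 1" "of_real r / b"] r by (simp add: norm_divide B_def)
      also have "\<dots> \<le> y / B" using B s' by (simp add: y_def L_def field_simps)
      finally have "(cmod (p r + 1))\<^sup>2 \<le> (y / B)\<^sup>2" by (intro power_mono) auto
      moreover have "p r + 1 \<noteq> 0" using Re_p_pos by (auto simp: complex_eq_iff)
      ultimately have "Re (p r) / (y / B)\<^sup>2 \<le> Re (p r) / (cmod (p r + 1))\<^sup>2"
        using Re_p_pos y B by (intro divide_left_mono mult_pos_pos) auto
      \<comment> \<open>The factors B^2 cancel: by the choice of the ray the coefficient here is the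
        same \<kappa> as in e^(-\<kappa>r), so the two exponents balance at y = \<mu>.\<close>
      moreover have "Re (p r) / (y / B)\<^sup>2 = \<kappa> * (y - D) / y\<^sup>2"
        using B y by (simp add: Re_p power_divide)
      ultimately have "\<mu>\<^sup>2 * (\<kappa> * (y - D) / y\<^sup>2) \<le> \<mu>\<^sup>2 * (Re (p r) / (cmod (p r + 1))\<^sup>2)"
        by (intro mult_left_mono) auto
      then have "exp (- (2 * real M * (Re (p r) / (cmod (p r + 1))\<^sup>2))) \<le> exp (- \<kappa> * (\<mu>\<^sup>2 * (y - D) / y\<^sup>2))"
        by (simp add: \<mu>(2) mult_ac)
      with norm_cayley_power_le[OF Re_p_pos, of M]
      have q: "cmod ((p r - 1) / (p r + 1)) ^ M \<le> exp (- \<kappa> * (\<mu>\<^sup>2 * (y - D) / y\<^sup>2))"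
        by linarith
      have "c * y \<le> 2 * Re (p r)"
        using mult_left_mono[OF yD, of "2 * (\<kappa> / B\<^sup>2)"] \<kappa> unfolding Re_p c_def by (simp add: mult.assoc)
      then have "sqrt c * sqrt y \<le> sqrt (2 * Re (p r))"
        by (simp flip: real_sqrt_mult)
      then have "cmod ((p r - 1) / (p r + 1)) ^ M / sqrt (2 * Re (p r)) \<le>
          exp (- \<kappa> * (\<mu>\<^sup>2 * (y - D) / y\<^sup>2)) / (sqrt c * sqrt y)"
        using q c y by (intro frac_le) auto
      then have "y ^ \<nu> * exp (- \<kappa> * r) * (cmod ((p r - 1) / (p r + 1)) ^ M / sqrt (2 * Re (p r))) \<le>
          y ^ \<nu> * exp (- \<kappa> * r) * (exp (- \<kappa> * (\<mu>\<^sup>2 * (y - D) / y\<^sup>2)) / (sqrt c * sqrt y))"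
        using y by (intro mult_left_mono) auto
      also have "\<dots> = exp (\<kappa> * L) / sqrt c * (y ^ \<nu> / sqrt y * exp (- \<kappa> * (y + \<mu>\<^sup>2 * (y - D) / y\<^sup>2)))"
      proof -
        define X where "X = \<mu>\<^sup>2 * (y - D) / y\<^sup>2"
        have "exp (- \<kappa> * r) * exp (- \<kappa> * X) = exp (\<kappa> * L) * exp (- \<kappa> * (y + X))"
          by (simp add: exp_add[symmetric] y_def algebra_simps)
        then have "y ^ \<nu> * (exp (- \<kappa> * r) * exp (- \<kappa> * X)) / (sqrt c * sqrt y) =
            y ^ \<nu> * (exp (\<kappa> * L) * exp (- \<kappa> * (y + X))) / (sqrt c * sqrt y)" by (rule arg_cong)
        then show ?thesis unfolding X_def[symmetric] by (simp add: mult_ac)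
      qed
      also have "\<dots> \<le> exp (\<kappa> * L) / sqrt c * (C1 * exp (- 2 * \<kappa> * \<mu>) * W r)"
        using C1(2)[OF y(1) \<mu>(1)] c unfolding W_def y_def by (intro mult_left_mono) auto
      also have "\<dots> = C3 * exp (- 2 * \<kappa> * \<mu>) * W r" by (simp add: C3_def)
      finally show ?thesis by (simp add: y_def)
    qed
    have "(\<integral>\<^sup>+r. ennreal (indicat_real {0..} r * ((r + L) ^ \<nu> * exp (- \<kappa> * r) *
        (cmod ((p r - 1) / (p r + 1)) ^ M / sqrt (2 * Re (p r))))) \<partial>lborel) \<le>
      (\<integral>\<^sup>+r. ennreal (C3 * exp (- 2 * \<kappa> * \<mu>)) * ennreal (indicat_real {0..} r * W r) \<partial>lborel)"
      using le C3 by (intro nn_integral_mono) (auto simp: ennreal_mult'[symmetric] split: split_indicator intro!: ennreal_leI)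
    also have "\<dots> = ennreal (C3 * exp (- 2 * \<kappa> * \<mu>)) * (\<integral>\<^sup>+r. ennreal (indicat_real {0..} r * W r) \<partial>lborel)"
      unfolding W_def by (intro nn_integral_cmult) measurable
    also have "\<dots> \<le> ennreal (C3 * exp (- 2 * \<kappa> * \<mu>)) * ennreal (C2 * \<mu> ^ \<nu>)"
      unfolding W_def by (intro mult_left_mono C2(2) \<mu>) simp
    also have "\<dots> = ennreal (C3 * C2 * exp (- 2 * \<kappa> * \<mu>) * \<mu> ^ \<nu>)"
      using C2(1) C3 \<mu>(1) by (subst ennreal_mult[symmetric]) (simp_all add: mult_ac)
    finally show "(\<integral>\<^sup>+r. ennreal (indicat_real {0..} r * ((r + L) ^ \<nu> * exp (- Re b * r) *
       (cmod ((s + of_real r / b - 1) / (s + of_real r / b + 1)) ^ M / sqrt (2 * Re (s + of_real r / b))))) \<partial>lborel)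
      \<le> ennreal (C3 * C2 * exp (- 2 * Re b * sqrt (2 * real M)) * sqrt (2 * real M) ^ \<nu>)"
      by (simp only: \<mu>_def \<kappa>_def p_def)
  qed
qed

lemma laguerre_space_sum: "(\<lambda>x. \<Sum>n<Suc N. d n * laguerre_fun n x) \<in> laguerre_space N"
  unfolding laguerre_space_eq by (simp add: lessThan_Suc_atMost)

text \<open>Each exponential under the integral is replaced by its Laguerre projection. Integrating
  the coefficients over \<open>r\<close> gives the approximant, and Minkowski's inequality bounds
  the error by the integral of the exact single errors.\<close>

lemma laplace_transform_approximation:
  fixes b s :: complex and Q :: "real \<Rightarrow> complex"
  assumes b: "Re b > 0" and s: "Re s > 0"
    and Q_meas [measurable]: "Q \<in> borel_measurable borel"
    and Q_bound: "\<And>r. r \<ge> 0 \<Longrightarrow> cmod (Q r) \<le> K * (1 + r) ^ \<nu>"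
    and f: "\<And>x. x \<ge> 0 \<Longrightarrow> f x =
      (\<integral>r. indicat_real {0..} r *\<^sub>R (Q r * exp (- (b * of_real r)) * exp (- ((s + of_real r / b) * of_real x))) \<partial>lborel)"
  obtains C where "C > 0" "\<And>N. \<exists>u\<in>laguerre_space N.
    L2_norm (\<lambda>x. f x - u x) \<le> ereal (C * exp (- 2 * Re b * sqrt (2 * real (Suc N))) * sqrt (2 * real (Suc N)) ^ \<nu>)"
proof -
  define p where "p r = s + of_real r / b" for r :: real
  define q where "q r = (p r - 1) / (p r + 1)" for r
  define A where "A r = indicat_real {0..} r *\<^sub>R (Q r * exp (- (b * of_real r)))" for r
  have p_meas [measurable]: "p \<in> borel_measurable borel"
    and q_meas [measurable]: "q \<in> borel_measurable borel"
    and A_meas [measurable]: "A \<in> borel_measurable borel"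
    unfolding p_def q_def A_def by measurable
  have Re_p: "Re (p r) > 0" if "r \<ge> 0" for r
    using s b that unfolding p_def by (simp add: Re_divide add_pos_nonneg)
  obtain L C where LC: "1 \<le> L" "C > 0" "\<And>M. M \<ge> 1 \<Longrightarrow>
    (\<integral>\<^sup>+r. ennreal (indicat_real {0..} r * ((r + L) ^ \<nu> * exp (- Re b * r) *
       (cmod ((s + of_real r / b - 1) / (s + of_real r / b + 1)) ^ M / sqrt (2 * Re (s + of_real r / b))))) \<partial>lborel)
    \<le> ennreal (C * exp (- 2 * Re b * sqrt (2 * real M)) * sqrt (2 * real M) ^ \<nu>)"
    by (rule laplace_weight_bound[OF b s, where \<nu> = \<nu>]) (rule that)
  \<comment> \<open>The maximum keeps the final constant strictly positive, as \<open>K\<close> may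
    be 0.\<close>
  define K' where "K' = max K 1"
  have K': "K' \<ge> K" "K' > 0" by (auto simp: K'_def)
  have A_bound: "cmod (A r) \<le> K' * (indicat_real {0..} r * ((r + L) ^ \<nu> * exp (- Re b * r)))" for r
  proof (cases "r \<ge> 0")
    case True
    have "cmod (Q r) \<le> K * (1 + r) ^ \<nu>" using Q_bound True .
    also have "\<dots> \<le> K' * (r + L) ^ \<nu>"
      using K' LC(1) True by (intro mult_mono power_mono) auto
    finally have "cmod (Q r) * exp (- Re b * r) \<le> K' * (r + L) ^ \<nu> * exp (- Re b * r)"
      by (intro mult_right_mono) auto
    then show ?thesis using True by (simp add: A_def norm_mult mult.assoc)
  qed (simp add: A_def)
  have "integrable lborel (\<lambda>r. K' * (indicat_real {0..} r * ((r + L) ^ \<nu> * exp (- Re b * r))))"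
    using b LC(1) by (intro integrable_mult_right integrable_shifted_power_exp) auto
  then have A_int: "integrable lborel A"
  proof (rule Bochner_Integration.integrable_bound)
    show "AE r in lborel. norm (A r) \<le>
        norm (K' * (indicat_real {0..} r * ((r + L) ^ \<nu> * exp (- Re b * r))))"
      using order.trans[OF A_bound abs_ge_self] by (intro AE_I2) (simp only: real_norm_def)
  qed simp
  \<comment> \<open>A bound for r \<ge> 0 is enough since \<open>A\<close> vanishes for r < 0. It is
    used with 1 for the exponentials and 2 for the projection coefficients.\<close>
  have A_mult_int: "integrable lborel (\<lambda>r. A r * h r)"
    if [measurable]: "h \<in> borel_measurable borel" and h: "\<And>r. r \<ge> 0 \<Longrightarrow> cmod (h r) \<le> c"
    for h :: "real \<Rightarrow> complex" and c
  proof (rule Bochner_Integration.integrable_bound)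
    show "integrable lborel (\<lambda>r. of_real c * A r)" using A_int by (rule integrable_mult_right)
    have "cmod (A r * h r) \<le> cmod (of_real c * A r)" for r
    proof (cases "r \<ge> 0")
      case True
      have "cmod (A r) * cmod (h r) \<le> cmod (A r) * \<bar>c\<bar>"
        using h[OF True] by (intro mult_left_mono) auto
      then show ?thesis by (simp add: norm_mult mult.commute)
    qed (simp add: A_def)
    then show "AE r in lborel. norm (A r * h r) \<le> norm (of_real c * A r)" by simp
  qed measurable
  have exp_int: "integrable lborel (\<lambda>r. A r * exp (- (p r * of_real x)))" if "x \<ge> 0" for x :: real
    using that Re_p less_imp_le by (intro A_mult_int[where c = 1]) (auto intro!: mult_nonneg_nonneg)
  have coeff_bound: "cmod (2 / (p r + 1) * q r ^ n) \<le> 2" if r: "r \<ge> 0" for r n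
  proof -
    have "1 \<le> cmod (p r + 1)" using Re_p[OF r] complex_Re_le_cmod[of "p r + 1"] by simp
    moreover have "cmod (q r) ^ n \<le> 1"
      using norm_cayley_le_1[OF Re_p[OF r]] by (intro power_le_one) (auto simp: q_def)
    ultimately have "2 / cmod (p r + 1) * cmod (q r) ^ n \<le> 2 * 1"
      by (intro mult_mono) (auto simp: divide_le_eq)
    then show ?thesis by (simp add: norm_mult norm_divide norm_power)
  qed
  have coeff_int: "integrable lborel (\<lambda>r. A r * (2 / (p r + 1) * q r ^ n))" for n
    using coeff_bound by (intro A_mult_int[where c = 2]) auto
  show thesis
  proof (rule that)
    show "K' * C > 0" using K' LC(2) by simp
    fix N
    \<comment> \<open>\<open>laguerre_space N\<close> contains the N + 1 functions of index 0 to
      N.\<close>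
    define M where "M = Suc N"
    define d where "d n = (\<integral>r. A r * (2 / (p r + 1) * q r ^ n) \<partial>lborel)" for n
    define E where "E r x = A r * exp_laguerre_remainder M (p r) x" for r x
    define g where "g x = (\<integral>r. E r x \<partial>lborel)" for x
    have E_meas: "(\<lambda>(r, x). E r x) \<in> borel_measurable (lborel \<Otimes>\<^sub>M lborel)"
      unfolding E_def exp_laguerre_remainder_def by measurable
    then have [measurable]: "(\<lambda>z. E (fst z) (snd z)) \<in> borel_measurable (lborel \<Otimes>\<^sub>M lborel)"
      by (simp add: case_prod_unfold)
    have E_eq: "E r x = A r * exp (- (p r * of_real x)) -
        (\<Sum>n<M. laguerre_fun n x * (A r * (2 / (p r + 1) * q r ^ n)))" for r x
      by (simp add: E_def exp_laguerre_remainder_def q_def right_diff_distrib sum_distrib_left mult_ac)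
    have E_int: "integrable lborel (\<lambda>r. E r x)" if "x \<ge> 0" for x
      unfolding E_eq using exp_int[OF that] coeff_int
      by (intro Bochner_Integration.integrable_diff Bochner_Integration.integrable_sum integrable_mult_right)
    have g_eq: "f x - (\<Sum>n<M. d n * laguerre_fun n x) = g x" if x: "x \<ge> 0" for x
    proof -
      have "g x = (\<integral>r. A r * exp (- (p r * of_real x)) \<partial>lborel) -
          (\<integral>r. (\<Sum>n<M. laguerre_fun n x * (A r * (2 / (p r + 1) * q r ^ n))) \<partial>lborel)"
        unfolding g_def E_eq using exp_int[OF x] coeff_int
        by (intro Bochner_Integration.integral_diff Bochner_Integration.integrable_sum integrable_mult_right)
      also have "(\<integral>r. (\<Sum>n<M. laguerre_fun n x * (A r * (2 / (p r + 1) * q r ^ n))) \<partial>lborel) =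
          (\<Sum>n<M. d n * laguerre_fun n x)"
      proof (subst Bochner_Integration.integral_sum)
        show "integrable lborel (\<lambda>r. laguerre_fun n x * (A r * (2 / (p r + 1) * q r ^ n)))" for n
          by (intro integrable_mult_right coeff_int)
        show "(\<Sum>n<M. \<integral>r. laguerre_fun n x * (A r * (2 / (p r + 1) * q r ^ n)) \<partial>lborel) =
            (\<Sum>n<M. d n * laguerre_fun n x)"
          unfolding d_def integral_mult_right_zero by (intro sum.cong refl mult.commute)
      qed
      also have "(\<integral>r. A r * exp (- (p r * of_real x)) \<partial>lborel) = f x"
        unfolding f[OF x] A_def p_def
        by (intro Bochner_Integration.integral_cong) (auto simp: scaleR_conv_of_real mult_ac)
      finally show ?thesis by simp
    qed
    \<comment> \<open>\<open>w r\<close> dominates the L2 norm of \<open>E r\<close> in the space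
      variable: the bound of \<open>A r\<close> times the exact norm of the remainder.\<close>
    define w where "w r = K' * (indicat_real {0..} r * ((r + L) ^ \<nu> * exp (- Re b * r) *
        (cmod (q r) ^ M / sqrt (2 * Re (p r)))))" for r
    define F where "F z = ennreal (indicat_real {0..} (snd z) * cmod (E (fst z) (snd z)))" for z
    have minkowski: "(\<integral>\<^sup>+x. (\<integral>\<^sup>+r. F (r, x) \<partial>lborel)\<^sup>2 \<partial>lborel) \<le> (\<integral>\<^sup>+r. ennreal (w r) \<partial>lborel)\<^sup>2"
    proof (rule nn_integral_Minkowski_squared)
      show "F \<in> borel_measurable (lborel \<Otimes>\<^sub>M lborel)" unfolding F_def by measurable
      show "w \<in> borel_measurable lborel" unfolding w_def by measurable
      show "0 \<le> w r" for r
        using K' LC(1) Re_p[of r] by (auto simp: w_def split: split_indicator)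
      have E_sq: "has_bochner_integral lborel (\<lambda>x. indicat_real {0..} x * (cmod (E r x))\<^sup>2)
          ((cmod (A r) * (cmod (q r) ^ M / sqrt (2 * Re (p r))))\<^sup>2)" if "r \<ge> 0" for r
      proof -
        have "has_bochner_integral lborel
           (\<lambda>x. (cmod (A r))\<^sup>2 * (indicat_real {0..} x * (cmod (exp_laguerre_remainder M (p r) x))\<^sup>2))
           ((cmod (A r))\<^sup>2 * (cmod (q r) ^ (2 * M) / (2 * Re (p r))))"
          unfolding q_def by (intro has_bochner_integral_mult_right has_bochner_integral_norm_remainder_squared Re_p that)
        moreover have "cmod (q r) ^ (2 * M) = (cmod (q r) ^ M)\<^sup>2"
          by (simp add: power_mult[symmetric] mult.commute)
        ultimately show ?thesis
          using Re_p[OF that] by (simp add: E_def norm_mult power_mult_distrib power_divide mult_ac)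
      qed
      show "(\<integral>\<^sup>+x. (F (r, x))\<^sup>2 \<partial>lborel) \<le> ennreal ((w r)\<^sup>2)" for r
      proof (cases "r \<ge> 0")
        case True
        have "(\<integral>\<^sup>+x. (F (r, x))\<^sup>2 \<partial>lborel) =
            (\<integral>\<^sup>+x. ennreal (indicat_real {0..} x * (cmod (E r x))\<^sup>2) \<partial>lborel)"
          by (intro nn_integral_cong) (auto simp: F_def ennreal_power split: split_indicator)
        also have "\<dots> = ennreal ((cmod (A r) * (cmod (q r) ^ M / sqrt (2 * Re (p r))))\<^sup>2)"
          using E_sq[OF True] by (subst nn_integral_eq_integral)
            (auto simp: has_bochner_integral_iff)
        also have "cmod (A r) * (cmod (q r) ^ M / sqrt (2 * Re (p r))) \<le> w r"
          using mult_right_mono[OF A_bound[of r], of "cmod (q r) ^ M / sqrt (2 * Re (p r))"] Re_p[OF True]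
          by (simp add: w_def mult.assoc)
        then have "ennreal ((cmod (A r) * (cmod (q r) ^ M / sqrt (2 * Re (p r))))\<^sup>2) \<le> ennreal ((w r)\<^sup>2)"
          using Re_p[OF True] by (intro ennreal_leI power_mono) auto
        finally show ?thesis .
      qed (simp add: F_def E_def A_def)
      \<comment> \<open>For r \<ge> 0 the weight vanishes only if p = 1. Then the exponential is
        \<open>laguerre_fun 0\<close>, and as M \<ge> 1 the projection reproduces it
        exactly.\<close>
      show "F (r, x) = 0" if "w r = 0" for r x
      proof (cases "r \<ge> 0")
        case True
        have "r + L \<noteq> 0" using True LC(1) by simp
        with True K' that Re_p[OF True] have "cmod (q r) ^ M = 0" by (auto simp: w_def)
        then have "q r = 0" by simp
        moreover have "p r + 1 \<noteq> 0" using Re_p[OF True] by (auto simp: complex_eq_iff)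
        ultimately have "p r = 1" by (simp add: q_def)
        then have "exp_laguerre_remainder M (p r) x = 0"
          unfolding exp_laguerre_remainder_def M_def sum.lessThan_Suc_shift
          by (simp add: laguerre_fun_def laguerre_poly_def exp_of_real[symmetric])
        then show ?thesis by (simp add: F_def E_def)
      qed (simp add: F_def E_def A_def)
    qed (simp_all add: sigma_finite_lborel)
    show "\<exists>u\<in>laguerre_space N. L2_norm (\<lambda>x. f x - u x) \<le>
        ereal (K' * C * exp (- 2 * Re b * sqrt (2 * real (Suc N))) * sqrt (2 * real (Suc N)) ^ \<nu>)"
    proof (rule bexI)
      define W where "W = K' * C * exp (- 2 * Re b * sqrt (2 * real M)) * sqrt (2 * real M) ^ \<nu>"
      have W: "W \<ge> 0" using K' LC(2) by (simp add: W_def)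
      have "(\<integral>\<^sup>+r. ennreal (w r) \<partial>lborel) = ennreal K' *
        (\<integral>\<^sup>+r. ennreal (indicat_real {0..} r * ((r + L) ^ \<nu> * exp (- Re b * r) *
          (cmod (q r) ^ M / sqrt (2 * Re (p r))))) \<partial>lborel)"
        unfolding w_def
        by (subst nn_integral_cmult[symmetric], measurable) (simp only: ennreal_mult'[OF less_imp_le[OF K'(2)]])
      also have "\<dots> \<le> ennreal K' * ennreal (C * exp (- 2 * Re b * sqrt (2 * real M)) * sqrt (2 * real M) ^ \<nu>)"
        unfolding q_def p_def by (intro mult_left_mono LC(3)) (auto simp: M_def)
      also have "\<dots> = ennreal W"
        using K' by (simp add: W_def ennreal_mult'[symmetric] mult.assoc)
      finally have w_le: "(\<integral>\<^sup>+r. ennreal (w r) \<partial>lborel) \<le> ennreal W" .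
      have g_bound: "(\<integral>\<^sup>+x. ennreal (indicat_real {0..} x * (cmod (g x))\<^sup>2) \<partial>lborel) \<le> (ennreal W)\<^sup>2"
      proof -
        \<comment> \<open>For x \<ge> 0 this is the triangle inequality for the integral defining
          \<open>g\<close>; elsewhere the left side is 0.\<close>
        have "ennreal (indicat_real {0..} x * (cmod (g x))\<^sup>2) \<le> (\<integral>\<^sup>+r. F (r, x) \<partial>lborel)\<^sup>2" for x
        proof (cases "x \<ge> 0")
          case True
          have "ennreal (cmod (g x)) \<le> (\<integral>\<^sup>+r. F (r, x) \<partial>lborel)"
            using integral_norm_bound_ennreal[OF E_int[OF True]] True by (simp add: F_def g_def)
          then have "(ennreal (cmod (g x)))\<^sup>2 \<le> (\<integral>\<^sup>+r. F (r, x) \<partial>lborel)\<^sup>2"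
            by (intro power_mono) auto
          with True show ?thesis by (simp add: ennreal_power)
        qed simp
        then have "(\<integral>\<^sup>+x. ennreal (indicat_real {0..} x * (cmod (g x))\<^sup>2) \<partial>lborel) \<le>
            (\<integral>\<^sup>+x. (\<integral>\<^sup>+r. F (r, x) \<partial>lborel)\<^sup>2 \<partial>lborel)"
          by (intro nn_integral_mono)
        also note minkowski
        also have "(\<integral>\<^sup>+r. ennreal (w r) \<partial>lborel)\<^sup>2 \<le> (ennreal W)\<^sup>2"
          using w_le by (intro power_mono) auto
        finally show ?thesis .
      qed
      have g_meas: "g \<in> borel_measurable borel"
      proof -
        have "(\<lambda>x. \<integral>r. E r x \<partial>lborel) \<in> borel_measurable lborel"
          unfolding E_def exp_laguerre_remainder_def
          by (rule lborel.borel_measurable_lebesgue_integral) measurable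
        then show ?thesis by (simp add: g_def[abs_def])
      qed
      show "(\<lambda>x. \<Sum>n<Suc N. d n * laguerre_fun n x) \<in> laguerre_space N"
        by (rule laguerre_space_sum)
      have "L2_norm (\<lambda>x. f x - (\<Sum>n<Suc N. d n * laguerre_fun n x)) \<le> ereal W"
        using g_eq by (intro L2_norm_le[OF g_meas g_bound W]) (simp add: M_def)
      then show "L2_norm (\<lambda>x. f x - (\<Sum>n<Suc N. d n * laguerre_fun n x)) \<le>
        ereal (K' * C * exp (- 2 * Re b * sqrt (2 * real (Suc N))) * sqrt (2 * real (Suc N)) ^ \<nu>)"
        by (simp only: W_def M_def)
    qed
  qed
qed

section \<open>The Hankel function as a Laplace transform\<close>

lemma inverse_power_laplace:
  assumes b: "Re b > 0" and x: "x \<ge> 0"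
  shows "has_bochner_integral lborel
    (\<lambda>r. indicat_real {0..} r *\<^sub>R (of_real r ^ m * exp (- (b * of_real r)) * exp (- ((s + of_real r / b) * of_real x))))
    (fact m * b ^ Suc m * exp (- (s * of_real x)) / (of_real x + b\<^sup>2) ^ Suc m)"
proof -
  have b0: "b \<noteq> 0" using b by auto
  \<comment> \<open>The formula for power-exponential integrals is applied at z = x/b + b = (x +
    b^2)/b, which has positive real part because 1/b lies in the right half plane together with
    \<open>b\<close>.\<close>
  have "Re (of_real x / b + b) > 0"
    using b x by (simp add: Re_divide add_nonneg_pos)
  from has_bochner_integral_mult_right[OF has_bochner_integral_power_exp[OF this, of m], of "exp (- (s * of_real x))"]
  have "has_bochner_integral lborel
    (\<lambda>r. exp (- (s * of_real x)) * (indicat_real {0..} r *\<^sub>R (of_real r ^ m * exp (- ((of_real x / b + b) * of_real r)))))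
    (exp (- (s * of_real x)) * (fact m / (of_real x / b + b) ^ Suc m))" .
  moreover have "exp (- (s * of_real x)) * exp (- ((of_real x / b + b) * of_real r)) =
      exp (- (b * of_real r)) * exp (- ((s + of_real r / b) * of_real x))" for r :: real
    by (simp add: exp_add[symmetric] algebra_simps)
  then have "exp (- (s * of_real x)) * (indicat_real {0..} r *\<^sub>R (of_real r ^ m * exp (- ((of_real x / b + b) * of_real r)))) =
     indicat_real {0..} r *\<^sub>R (of_real r ^ m * exp (- (b * of_real r)) * exp (- ((s + of_real r / b) * of_real x)))" for r
    by (simp add: scaleR_conv_of_real mult.left_commute mult.assoc)
  moreover have "of_real x / b + b = (of_real x + b\<^sup>2) / b"
    using b0 by (simp add: field_simps power2_eq_square)
  then have "exp (- (s * of_real x)) * (fact m / (of_real x / b + b) ^ Suc m) =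
      fact m * b ^ Suc m * exp (- (s * of_real x)) / (of_real x + b\<^sup>2) ^ Suc m"
    unfolding \<open>of_real x / b + b = _\<close> power_divide by simp
  ultimately show ?thesis by (simp only:)
qed

theorem theorem5p13:
  fixes \<nu> :: nat and R :: real and \<omega> \<sigma> :: complex
  assumes "R > 0" and "Im \<sigma> > 0" and "Im (\<sigma> * \<omega>) > 0"
  shows "\<exists>c1 c2 :: real. c1 > 0 \<and> c2 > 0 \<and>
    (\<forall>N::nat. N \<ge> 1 \<longrightarrow>
      (INF u\<in>laguerre_space N.
         L2_norm (\<lambda>\<xi>::real. spherical_hankel \<nu> (\<omega> * (complex_of_real R + \<sigma> * complex_of_real \<xi>)) - u \<xi>))
      \<le> ereal (c1 * cmod ((1 + \<i> * \<sigma> * \<omega>) / (1 - \<i> * \<sigma> * \<omega>)) ^ (N + 1)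
           + c2 * exp (- 2 * Re (csqrt (complex_of_real (2 * R * real (N + 1)) / \<sigma>)))
                * real (N + 1) powr (real \<nu> / 2)))"
proof -
  define a where "a = of_real R / \<sigma>"
  define b where "b = csqrt a"
  define s where "s = - (\<i> * \<sigma> * \<omega>)"
  define h where "h \<xi> = spherical_hankel \<nu> (\<omega> * (complex_of_real R + \<sigma> * complex_of_real \<xi>))" for \<xi>
  have \<sigma>\<omega>: "\<sigma> \<noteq> 0" "\<omega> \<noteq> 0" using assms by auto
  have b2: "b\<^sup>2 = a" by (simp add: b_def)
  \<comment> \<open>As \<open>a\<close> is not real, its principal root cannot be purely imaginary;
    hence Re b > 0 strictly.\<close>
  have Im_a: "Im a \<noteq> 0"
    using assms \<sigma>\<omega> by (simp add: a_def Im_divide complex_neq_0)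
  have b: "Re b > 0"
  proof -
    have "Re b \<noteq> 0"
    proof
      assume "Re b = 0"
      then have "Im (b\<^sup>2) = 0" by (simp add: power2_eq_square)
      with b2 Im_a show False by simp
    qed
    then show ?thesis using csqrt_principal[of a] by (auto simp: b_def)
  qed
  have s: "Re s > 0" using assms by (simp add: s_def algebra_simps)
  \<comment> \<open>From R + \<sigma>x = \<sigma>(x + a): \<open>c m\<close> collects the constants
    of the \<open>m\<close>-th Hankel term, and \<open>k m\<close> divides out the factor m! b^(m+1)
    produced by \<open>inverse_power_laplace\<close>.\<close>
  define c where "c m = - \<i> * exp (\<i> * \<omega> * R) * (- \<i>) ^ \<nu> * (\<i> ^ m / (fact m * 2 ^ m) *
     (fact (\<nu> + m) / fact (\<nu> - m))) / (\<omega> * \<sigma>) ^ Suc m" for m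
  define k where "k m = c m / (fact m * b ^ Suc m)" for m
  define Q where "Q r = (\<Sum>m\<le>\<nu>. k m * of_real r ^ m)" for r :: real
  have h_eq: "h x = (\<Sum>m\<le>\<nu>. c m * (exp (- (s * of_real x)) / (of_real x + a) ^ Suc m))" for x
  proof -
    define z where "z = of_real x + a"
    have z: "\<omega> * (complex_of_real R + \<sigma> * complex_of_real x) = (\<omega> * \<sigma>) * z"
      using \<sigma>\<omega> by (simp add: z_def a_def field_simps)
    have "\<i> * (\<omega> * \<sigma> * z) = \<i> * \<omega> * R + - (s * of_real x)"
      unfolding z[symmetric] by (simp add: s_def algebra_simps)
    then have e: "exp (\<i> * (\<omega> * \<sigma> * z)) = exp (\<i> * \<omega> * R) * exp (- (s * of_real x))"
      by (simp only: exp_add)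
    show ?thesis
      unfolding h_def spherical_hankel_def z e sum_distrib_left z_def[symmetric]
      by (intro sum.cong refl) (simp add: c_def power_mult_distrib mult_ac)
  qed
  have h_laplace: "h x = (\<integral>r. indicat_real {0..} r *\<^sub>R (Q r * exp (- (b * of_real r)) *
      exp (- ((s + of_real r / b) * of_real x))) \<partial>lborel)" if x: "x \<ge> 0" for x
  proof -
    have "has_bochner_integral lborel (\<lambda>r. \<Sum>m\<le>\<nu>. k m * (indicat_real {0..} r *\<^sub>R
        (of_real r ^ m * exp (- (b * of_real r)) * exp (- ((s + of_real r / b) * of_real x)))))
      (\<Sum>m\<le>\<nu>. k m * (fact m * b ^ Suc m * exp (- (s * of_real x)) / (of_real x + b\<^sup>2) ^ Suc m))"
      by (intro has_bochner_integral_sum has_bochner_integral_mult_right inverse_power_laplace b x)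
    also have "(\<Sum>m\<le>\<nu>. k m * (fact m * b ^ Suc m * exp (- (s * of_real x)) / (of_real x + b\<^sup>2) ^ Suc m)) = h x"
      unfolding h_eq b2 using b by (intro sum.cong refl) (auto simp: k_def)
    also have "(\<lambda>r. \<Sum>m\<le>\<nu>. k m * (indicat_real {0..} r *\<^sub>R
        (of_real r ^ m * exp (- (b * of_real r)) * exp (- ((s + of_real r / b) * of_real x))))) =
      (\<lambda>r. indicat_real {0..} r *\<^sub>R (Q r * exp (- (b * of_real r)) * exp (- ((s + of_real r / b) * of_real x))))"
      by (simp add: Q_def sum_distrib_left sum_distrib_right scaleR_conv_of_real mult_ac)
    finally show ?thesis by (simp add: has_bochner_integral_iff)
  qed
  have Q_bound: "cmod (Q r) \<le> (\<Sum>m\<le>\<nu>. cmod (k m)) * (1 + r) ^ \<nu>" if r: "r \<ge> 0" for r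
  proof -
    have "cmod (Q r) \<le> (\<Sum>m\<le>\<nu>. cmod (k m) * (1 + r) ^ \<nu>)"
      unfolding Q_def
    proof (rule sum_norm_le)
      fix m assume m: "m \<in> {..\<nu>}"
      have "r ^ m \<le> (1 + r) ^ m" using r by (intro power_mono) auto
      also have "\<dots> \<le> (1 + r) ^ \<nu>" using r m by (intro power_increasing) auto
      finally show "cmod (k m * of_real r ^ m) \<le> cmod (k m) * (1 + r) ^ \<nu>"
        using r by (simp add: norm_mult norm_power mult_left_mono)
    qed
    then show ?thesis by (simp add: sum_distrib_right)
  qed
  have Q_meas: "Q \<in> borel_measurable borel" unfolding Q_def by measurable
  obtain C where C: "C > 0" "\<And>N. \<exists>u\<in>laguerre_space N. L2_norm (\<lambda>x. h x - u x) \<le>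
      ereal (C * exp (- 2 * Re b * sqrt (2 * real (Suc N))) * sqrt (2 * real (Suc N)) ^ \<nu>)"
    by (rule laplace_transform_approximation[OF b s Q_meas Q_bound h_laplace]) (assumption | rule that)+
  \<comment> \<open>The geometric term enters with coefficient 1 and is bounded below by 0; the
    approximation bound itself becomes the second term.\<close>
  have bound: "(INF u\<in>laguerre_space N. L2_norm (\<lambda>\<xi>. h \<xi> - u \<xi>)) \<le>
      ereal (1 * cmod ((1 + \<i> * \<sigma> * \<omega>) / (1 - \<i> * \<sigma> * \<omega>)) ^ (N + 1)
         + C * 2 powr (\<nu> / 2) * exp (- 2 * Re (csqrt (complex_of_real (2 * R * real (N + 1)) / \<sigma>)))
                * real (N + 1) powr (real \<nu> / 2))" for N
  proof -
    define M where "M = real (N + 1)"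
    have M: "M > 0" by (simp add: M_def)
    \<comment> \<open>Positive scaling commutes with the principal root: the square is right and the
      real part is positive. This turns Re b sqrt(2M) into the stated exponent.\<close>
    have "csqrt (complex_of_real (2 * R * M) / \<sigma>) = of_real (sqrt (2 * M)) * b"
    proof (rule csqrt_unique)
      have "(complex_of_real (sqrt (2 * M)))\<^sup>2 = of_real (2 * M)"
        using M by (simp flip: of_real_power)
      then show "(of_real (sqrt (2 * M)) * b)\<^sup>2 = complex_of_real (2 * R * M) / \<sigma>"
        by (simp add: power_mult_distrib b2 a_def)
    qed (use b M in simp)
    then have e: "2 * Re b * sqrt (2 * M) = 2 * Re (csqrt (complex_of_real (2 * R * M) / \<sigma>))"
      by simp
    have "sqrt (2 * M) ^ \<nu> = (2 * M) powr (\<nu> / 2)"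
      using M by (simp add: powr_half_sqrt[symmetric] powr_power)
    also have "\<dots> = 2 powr (\<nu> / 2) * M powr (\<nu> / 2)"
      using M by (simp add: powr_mult)
    finally have p: "sqrt (2 * M) ^ \<nu> = 2 powr (\<nu> / 2) * M powr (\<nu> / 2)" .
    obtain u where u: "u \<in> laguerre_space N" "L2_norm (\<lambda>x. h x - u x) \<le>
        ereal (C * exp (- (2 * Re b * sqrt (2 * M))) * sqrt (2 * M) ^ \<nu>)"
      using C(2)[of N] by (auto simp: M_def)
    have "(INF u\<in>laguerre_space N. L2_norm (\<lambda>\<xi>. h \<xi> - u \<xi>)) \<le>
        ereal (C * exp (- (2 * Re b * sqrt (2 * M))) * sqrt (2 * M) ^ \<nu>)"
      by (intro INF_lower2[OF u(1)] u(2))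
    also have "\<dots> \<le> ereal (1 * cmod ((1 + \<i> * \<sigma> * \<omega>) / (1 - \<i> * \<sigma> * \<omega>)) ^ (N + 1)
         + C * 2 powr (\<nu> / 2) * exp (- 2 * Re (csqrt (complex_of_real (2 * R * M) / \<sigma>)))
                * M powr (real \<nu> / 2))"
      unfolding e p by simp
    finally show ?thesis unfolding M_def .
  qed
  have "C * 2 powr (\<nu> / 2) > 0" using C by simp
  with bound show ?thesis unfolding h_def using zero_less_one by blast
qed

end
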